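(* Let $S_b$ be the set consisting of all four type 1 oriented Reidemeister moves and $\Omega3b$. Neither of the two sets $S_b\cup\{\Omega2a,\Omega2c\}$ and $S_b\cup\{\Omega2a,\Omega2d\}$ generates $\Omega2b$.
   Context: Diagrams are oriented, with only transversal double points and over/undercrossing information. The sign of a crossing is $+$ if (direction of the over-strand, direction of the under-strand) is a positively oriented basis of $\mathbb{R}^2$, and $-$ otherwise. Oriented Reidemeister moves. A move replaces the part of an oriented diagram inside an embedded disk $C\subset\mathbb{R}^2$ (the changing disk), oriented by the standard orientation of $\mathbb{R}^2$, by another one with the same boundary points, leaving the diagram unchanged outside $C$; the two local pictures are taken up to orientation-preserving diffeomorphism of $C$ (the same on $\partial C$ for both). No distinction is made between a move and its inverse. Type 1 moves: a single arc without crossings in $C$ is replaced by an arc with exactly one crossing, i.e. by an arc with one loop (kink); the four moves correspond to the sign of the crossing and the direction (clockwise or counter-clockwise) of the loop. Type 2 moves: two disjoint arcs without crossings in $C$ are replaced by two arcs crossing each other at exactly two points that bound a bigon, the same arc being the over-strand at both crossings (the two crossings have opposite signs). $\Omega2a$: the two arcs pass through the crossings in the same order, first the positive one, then the negative one. $\Omega2b$: same order, first the negative one, then the positive one. $\Omega2c$: the two arcs pass through the crossings in opposite orders, the under-strand meeting first the positive crossing (and the over-strand first the negative one). $\Omega2d$: opposite orders, the over-strand meeting first the positive crossing (and the under-strand first the negative one). $\Omega3b$: $C$ contains three arcs (top, middle, bottom) without self-crossings, each two of which cross exactly once, with all three crossings positive; the move slides one arc across the crossing of the other two (so that the central triangle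 is reversed), keeping the endpoints, over/under information and signs. A set $S$ of moves generates a move $\Omega$ if $\Omega$ may be obtained by a finite sequence of isotopies and moves from $S$ (in either direction) inside the changing disk of $\Omega$. *)

theory Defs
  imports "HOL-Complex_Analysis.Complex_Analysis"
begin

text \<open>
  The plane \<open>\<real>\<^sup>2\<close> is the type \<^typ>\<open>complex\<close>; smooth means \<open>C\<^sup>\<infinity>\<close>.
\<close>

section \<open>Smooth maps, embedded disks\<close>

text \<open>
  The greatest family of functions that are differentiable on \<open>S\<close> and closed under directional
  derivatives. On the sets used below (the whole space, or \<open>[0,1] \<times> \<real>\<^sup>2\<close>, where derivatives
  within the set are unique) this is \<open>C\<^sup>\<infinity>\<close>.
\<close>

coinductive smooth_on :: "'a::real_normed_vector set \<Rightarrow> ('a \<Rightarrow> 'b::real_normed_vector) \<Rightarrow> bool"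
  for S where
  "(\<And>x. x \<in> S \<Longrightarrow> (f has_derivative f' x) (at x within S)) \<Longrightarrow>
   (\<And>h. smooth_on S (\<lambda>x. f' x h)) \<Longrightarrow> smooth_on S f"

definition diffeo :: "(complex \<Rightarrow> complex) \<Rightarrow> bool" where
  "diffeo f \<longleftrightarrow> bij f \<and> smooth_on UNIV f \<and> smooth_on UNIV (inv f)"

definition embedded_disk :: "complex set \<Rightarrow> bool" where
  "embedded_disk C \<longleftrightarrow> (\<exists>f. diffeo f \<and> C = f ` cball 0 1)"

definition det2 :: "complex \<Rightarrow> complex \<Rightarrow> real" where
  "det2 u v = Re u * Im v - Im u * Re v"

section \<open>Oriented diagrams\<close>

text \<open>
  A diagram is a finite list of closed oriented curves, each given by a 1-periodic
  parametrization \<open>\<real> \<rightarrow> \<real>\<^sup>2\<close>, so a point of the underlying abstract 1-manifold is a pair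
  (component, parameter) with the parameter taken modulo 1. The over/under information is the set
  of those points that are the upper preimage of a double point.
\<close>

record diagram =
  curves :: "(real \<Rightarrow> complex) list"
  over :: "(nat \<times> real) set"

type_synonym point = "nat \<times> real"

definition points :: "diagram \<Rightarrow> point set" where
  "points D = {(i, t). i < length (curves D)}"

fun same_point :: "point \<Rightarrow> point \<Rightarrow> bool" where
  "same_point (i, s) (j, t) \<longleftrightarrow> i = j \<and> s - t \<in> \<int>"

fun position :: "diagram \<Rightarrow> point \<Rightarrow> complex" where
  "position D (i, t) = (curves D ! i) t"

fun direction :: "diagram \<Rightarrow> point \<Rightarrow> complex" where
  "direction D (i, t) = vector_derivative (curves D ! i) (at t)"

definition double_pair :: "diagram \<Rightarrow> point \<Rightarrow> point \<Rightarrow> bool" where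
  "double_pair D p q \<longleftrightarrow> p \<in> points D \<and> q \<in> points D \<and> \<not> same_point p q \<and>
     position D p = position D q"

definition is_diagram :: "diagram \<Rightarrow> bool" where
  "is_diagram D \<longleftrightarrow>
     (\<forall>\<gamma> \<in> set (curves D). smooth_on UNIV \<gamma> \<and>
        (\<forall>t. \<gamma> (t + 1) = \<gamma> t \<and> vector_derivative \<gamma> (at t) \<noteq> 0)) \<and>
     (\<forall>p q. double_pair D p q \<longrightarrow> det2 (direction D p) (direction D q) \<noteq> 0) \<and>
     \<not> (\<exists>p q r. double_pair D p q \<and> double_pair D q r \<and> double_pair D p r) \<and>
     (\<forall>p q. double_pair D p q \<longrightarrow> (p \<in> over D \<longleftrightarrow> q \<notin> over D)) \<and>
     over D \<subseteq> {p. \<exists>q. double_pair D p q}"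

definition crossing :: "diagram \<Rightarrow> point \<Rightarrow> point \<Rightarrow> bool" where
  "crossing D p q \<longleftrightarrow> double_pair D p q \<and> p \<in> over D"

datatype sign = Pos | Neg

text \<open>The first point is the one on the over-strand.\<close>

definition crossing_sign :: "diagram \<Rightarrow> point \<Rightarrow> point \<Rightarrow> sign" where
  "crossing_sign D p q = (if det2 (direction D p) (direction D q) > 0 then Pos else Neg)"

text \<open>
  Two parametrized diagrams are the same oriented diagram if they differ by orientation-preserving
  reparametrizations of the components. Components are kept numbered, which is harmless because
  all moves below respect the numbering.
\<close>

definition same_diagram :: "diagram \<Rightarrow> diagram \<Rightarrow> bool" where
  "same_diagram D E \<longleftrightarrow> is_diagram D \<and> is_diagram E \<and> length (curves E) = length (curves D) \<and>
     (\<forall>i < length (curves D). \<exists>\<phi> :: real \<Rightarrow> real.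
        smooth_on UNIV \<phi> \<and> (\<forall>t. deriv \<phi> t > 0) \<and> (\<forall>t. \<phi> (t + 1) = \<phi> t + 1) \<and>
        (\<forall>t. (curves E ! i) t = (curves D ! i) (\<phi> t) \<and>
             ((i, t) \<in> over E \<longleftrightarrow> (i, \<phi> t) \<in> over D)))"

text \<open>Isotopies inside \<open>C\<close> are ambient isotopies of the plane that are the identity outside \<open>C\<close>.\<close>

definition isotopic_in :: "complex set \<Rightarrow> diagram \<Rightarrow> diagram \<Rightarrow> bool" where
  "isotopic_in C D E \<longleftrightarrow> is_diagram D \<and> is_diagram E \<and>
     (\<exists>H :: real \<Rightarrow> complex \<Rightarrow> complex.
        smooth_on ({0..1} \<times> UNIV) (\<lambda>(s, z). H s z) \<and>
        (\<forall>s \<in> {0..1}. diffeo (H s) \<and> (\<forall>z. z \<notin> C \<longrightarrow> H s z = z)) \<and>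
        (\<forall>z. H 0 z = z) \<and>
        curves E = map (\<lambda>\<gamma>. H 1 \<circ> \<gamma>) (curves D) \<and> over E = over D)"

section \<open>Replacing the part of a diagram inside a disk\<close>

text \<open>The arc \<open>(i, a, b)\<close> is the restriction of component \<open>i\<close> to the parameters \<open>[a, b]\<close>.\<close>

type_synonym arc = "nat \<times> real \<times> real"

fun arc_points :: "arc \<Rightarrow> point set" where
  "arc_points (i, a, b) = {(i, t + of_int m) | t m. a \<le> t \<and> t \<le> b}"

definition arcs_in :: "complex set \<Rightarrow> arc list \<Rightarrow> diagram \<Rightarrow> bool" where
  "arcs_in C As D \<longleftrightarrow>
     (\<forall>(i, a, b) \<in> set As. i < length (curves D) \<and> a < b \<and> b < a + 1 \<and>
        (curves D ! i) a \<in> frontier C \<and> (curves D ! i) b \<in> frontier C \<and>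
        (curves D ! i) ` {a<..<b} \<subseteq> interior C) \<and>
     sorted_wrt (\<lambda>A B. disjnt (arc_points A) (arc_points B)) As \<and>
     {p \<in> points D. position D p \<in> C} = (\<Union>A \<in> set As. arc_points A)"

text \<open>
  Both diagrams are parametrized so that they agree, as parametrized curves, outside the arcs
  in \<open>C\<close>. In particular the arcs have the same endpoints in both.
\<close>

definition replacement :: "complex set \<Rightarrow> arc list \<Rightarrow> diagram \<Rightarrow> diagram \<Rightarrow> bool" where
  "replacement C As D E \<longleftrightarrow> is_diagram D \<and> is_diagram E \<and> embedded_disk C \<and>
     arcs_in C As D \<and> arcs_in C As E \<and> length (curves E) = length (curves D) \<and>
     (\<forall>p \<in> points D - (\<Union>A \<in> set As. arc_points A).
        position E p = position D p \<and> (p \<in> over E \<longleftrightarrow> p \<in> over D))"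

text \<open>
  Since \<open>b < a + 1\<close>, parameters in \<open>[a, b]\<close> represent the points of an arc uniquely.
\<close>

fun embedded_arc :: "diagram \<Rightarrow> arc \<Rightarrow> bool" where
  "embedded_arc D (i, a, b) \<longleftrightarrow> inj_on (curves D ! i) {a..b}"

fun disjoint_arcs :: "diagram \<Rightarrow> arc \<Rightarrow> arc \<Rightarrow> bool" where
  "disjoint_arcs D (i, a, b) (j, c, d) \<longleftrightarrow>
     disjnt ((curves D ! i) ` {a..b}) ((curves D ! j) ` {c..d})"

section \<open>Moves of type 1\<close>

datatype rotation = Clockwise | Counterclockwise

definition loop_rotation :: "(real \<Rightarrow> complex) \<Rightarrow> real \<Rightarrow> real \<Rightarrow> rotation \<Rightarrow> bool" where
  "loop_rotation \<gamma> s t r \<longleftrightarrow>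
     (\<forall>z \<in> inside (path_image (subpath s t \<gamma>)).
        winding_number (subpath s t \<gamma>) z = (case r of Counterclockwise \<Rightarrow> 1 | Clockwise \<Rightarrow> - 1))"

definition kink :: "sign \<Rightarrow> rotation \<Rightarrow> diagram \<Rightarrow> arc \<Rightarrow> bool" where
  "kink e r D = (\<lambda>(i, a, b). \<exists>s t. a \<le> s \<and> s < t \<and> t \<le> b \<and>
     (\<forall>s' \<in> {a..b}. \<forall>t' \<in> {a..b}. s' < t' \<longrightarrow>
        ((curves D ! i) s' = (curves D ! i) t' \<longleftrightarrow> s' = s \<and> t' = t)) \<and>
     (crossing D (i, s) (i, t) \<and> crossing_sign D (i, s) (i, t) = e \<or>
      crossing D (i, t) (i, s) \<and> crossing_sign D (i, t) (i, s) = e) \<and>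
     loop_rotation (curves D ! i) s t r)"

definition move1 :: "sign \<Rightarrow> rotation \<Rightarrow> complex set \<Rightarrow> diagram \<Rightarrow> diagram \<Rightarrow> bool" where
  "move1 e r C D E \<longleftrightarrow>
     (\<exists>A. replacement C [A] D E \<and> embedded_arc D A \<and> kink e r E A)"

section \<open>Moves of type 2\<close>

text \<open>
  The over-strand \<open>(i, a, b)\<close> and the under-strand \<open>(j, c, d)\<close> cross exactly twice, at a positive
  crossing with parameters \<open>op\<close>, \<open>up\<close> on the over- and under-strand and at a negative crossing with
  parameters \<open>on\<close>, \<open>un\<close>. The argument \<open>ord\<close> prescribes the truth values of: the over-strand
  passes first the positive crossing; the under-strand passes first the positive crossing.
\<close>

definition bigon :: "bool \<times> bool \<Rightarrow> diagram \<Rightarrow> arc \<Rightarrow> arc \<Rightarrow> bool" where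
  "bigon ord D = (\<lambda>(i, a, b) (j, c, d). \<exists>op on up un.
     {op, on} \<subseteq> {a..b} \<and> {up, un} \<subseteq> {c..d} \<and> op \<noteq> on \<and> up \<noteq> un \<and>
     (\<forall>s \<in> {a..b}. \<forall>t \<in> {c..d}.
        (curves D ! i) s = (curves D ! j) t \<longleftrightarrow> s = op \<and> t = up \<or> s = on \<and> t = un) \<and>
     crossing D (i, op) (j, up) \<and> crossing_sign D (i, op) (j, up) = Pos \<and>
     crossing D (i, on) (j, un) \<and> crossing_sign D (i, on) (j, un) = Neg \<and>
     inside ((curves D ! i) ` closed_segment op on \<union> (curves D ! j) ` closed_segment up un)
       \<inter> position D ` points D = {} \<and>
     ord = (op < on, up < un))"

definition move2 :: "bool \<times> bool \<Rightarrow> complex set \<Rightarrow> diagram \<Rightarrow> diagram \<Rightarrow> bool" where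
  "move2 ord C D E \<longleftrightarrow>
     (\<exists>A B. replacement C [A, B] D E \<and>
        embedded_arc D A \<and> embedded_arc D B \<and> disjoint_arcs D A B \<and>
        embedded_arc E A \<and> embedded_arc E B \<and> bigon ord E A B)"

section \<open>The all-positive move of type 3\<close>

text \<open>The two arcs cross exactly once, positively, with the first one over, at the given parameters.\<close>

fun cross_once_pos :: "diagram \<Rightarrow> arc \<Rightarrow> arc \<Rightarrow> real \<Rightarrow> real \<Rightarrow> bool" where
  "cross_once_pos D (i, a, b) (j, c, d) u v \<longleftrightarrow> u \<in> {a..b} \<and> v \<in> {c..d} \<and>
     (\<forall>s \<in> {a..b}. \<forall>t \<in> {c..d}. (curves D ! i) s = (curves D ! j) t \<longleftrightarrow> s = u \<and> t = v) \<and>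
     crossing D (i, u) (j, v) \<and> crossing_sign D (i, u) (j, v) = Pos"

text \<open>
  The arcs \<open>T\<close>, \<open>M\<close>, \<open>B\<close> are the top, middle and bottom one. The argument \<open>ord\<close> prescribes which
  of its two crossings each arc meets first; reversing the central triangle means that all three
  of these orders are reversed.
\<close>

definition triangle_pos :: "bool \<times> bool \<times> bool \<Rightarrow> diagram \<Rightarrow> arc \<Rightarrow> arc \<Rightarrow> arc \<Rightarrow> bool" where
  "triangle_pos ord D T M B \<longleftrightarrow>
     embedded_arc D T \<and> embedded_arc D M \<and> embedded_arc D B \<and>
     (\<exists>tm mt tb bt mb bm.
        cross_once_pos D T M tm mt \<and> cross_once_pos D T B tb bt \<and> cross_once_pos D M B mb bm \<and>
        ord = (tm < tb, mt < mb, bt < bm))"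

definition move3b :: "complex set \<Rightarrow> diagram \<Rightarrow> diagram \<Rightarrow> bool" where
  "move3b C D E \<longleftrightarrow>
     (\<exists>T M B x y z. replacement C [T, M, B] D E \<and>
        triangle_pos (x, y, z) D T M B \<and> triangle_pos (\<not> x, \<not> y, \<not> z) E T M B)"

section \<open>Generation\<close>

datatype move = Omega1 sign rotation | Omega2a | Omega2b | Omega2c | Omega2d | Omega3b

fun is_move :: "move \<Rightarrow> complex set \<Rightarrow> diagram \<Rightarrow> diagram \<Rightarrow> bool" where
  "is_move (Omega1 e r) = move1 e r"
| "is_move Omega2a = move2 (True, True)"
| "is_move Omega2b = move2 (False, False)"
| "is_move Omega2c = move2 (False, True)"
| "is_move Omega2d = move2 (True, False)"
| "is_move Omega3b = move3b"

definition step_in :: "move set \<Rightarrow> complex set \<Rightarrow> diagram \<Rightarrow> diagram \<Rightarrow> bool" where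
  "step_in S C D E \<longleftrightarrow> same_diagram D E \<or> isotopic_in C D E \<or>
     (\<exists>m \<in> S. \<exists>C' \<subseteq> C. is_move m C' D E \<or> is_move m C' E D)"

definition generates :: "move set \<Rightarrow> move \<Rightarrow> bool" where
  "generates S m \<longleftrightarrow> (\<forall>C D E. is_move m C D E \<longrightarrow> (step_in S C)\<^sup>*\<^sup>* D E)"

definition S_b :: "move set" where
  "S_b = {Omega1 Pos Clockwise, Omega1 Pos Counterclockwise,
          Omega1 Neg Clockwise, Omega1 Neg Counterclockwise, Omega3b}"

end

theory Submission
  imports Defs
begin

text \<open>
  Consider the crossings at which component \<open>0\<close> runs over component \<open>1\<close>, and follow one of
  these two components once around, starting from a base point outside the changing disk. The signs
  of the crossings met on the way form a word in \<open>+\<close> and \<open>-\<close>. Call the diagram good if in no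
  initial segment of this word the letters \<open>-\<close> outnumber the letters \<open>+\<close>
  (\<open>based_ballot\<close>).

  Goodness is preserved by moves of three kinds. A move of type 1 changes only crossings of a
  component with itself. A move of type 2 at which the followed strand meets the positive crossing
  first inserts or deletes at most a subword \<open>+ -\<close>, and this does not affect the least
  balance of an initial segment. The move \<open>\<Omega>3b\<close> permutes crossings that are all positive, so it leaves the
  word unchanged. If the followed component is the one that runs below, then \<open>\<Omega>2a\<close> and
  \<open>\<Omega>2c\<close> are harmless, because in both of them the under-strand meets the positive crossing
  first. If it is the one that runs above, \<open>\<Omega>2a\<close> and \<open>\<Omega>2d\<close> are harmless, because there
  the over-strand does. Reparametrizations keep the word, and so do isotopies inside the disk, whose
  final diffeomorphisms preserve orientation and fix the base point (\<open>step_based_ballot\<close>).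

  In contrast, a move \<open>\<Omega>2b\<close> that pushes a finger of a circle under a disjoint second circle
  turns the empty word into \<open>- +\<close> on both components. It destroys goodness for both choices of the
  followed component and is therefore generated by neither set.

  Technically, a move exchanges the passages on finitely many arcs, and goodness survives
  if on each arc the totals agree and the new piece has no deficit in any initial segment
  (\<open>ballot_replace_arcs\<close>). The finger is explicit: it adds to the horizontal coordinate of a circle
  a function of the cosine that vanishes to infinite order where the circle enters the disk.
\<close>

section \<open>Smooth functions of one real variable\<close>

lemma smooth_on_derivative:
  assumes "smooth_on S f"
  shows "\<exists>f'. (\<forall>x\<in>S. (f has_derivative f' x) (at x within S)) \<and> (\<forall>h. smooth_on S (\<lambda>x. f' x h))"
  using assms by (cases rule: smooth_on.cases) blast

lemma smooth_on_imp_continuous_on: "smooth_on S f \<Longrightarrow> continuous_on S f"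
  by (metis smooth_on_derivative continuous_on_eq_continuous_within has_derivative_continuous)

lemma smooth_on_const: "smooth_on S (\<lambda>x. c)"
proof (coinduction arbitrary: c)
  case (smooth_on c)
  show ?case
    by (intro exI[of _ "\<lambda>_. c"] exI[of _ "\<lambda>_ _. 0"] conjI allI impI disjI1 refl has_derivative_const)
      (rule exI, rule refl)
qed

lemma smooth_on_ident: "smooth_on S (\<lambda>x. x)"
  by (rule smooth_on.intros[where f' = "\<lambda>_ h. h"]) (auto intro: smooth_on_const)

text \<open>
  The coinductive notion of smoothness is inconvenient for products and compositions. For functions
  of one real variable it amounts to being \<open>n\<close> times differentiable for every \<open>n\<close>, and
  then each closure property is an induction on \<open>n\<close>.
\<close>

primrec Ck :: "nat \<Rightarrow> (real \<Rightarrow> 'b::real_normed_vector) \<Rightarrow> bool" where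
  "Ck 0 f \<longleftrightarrow> True"
| "Ck (Suc n) f \<longleftrightarrow> (\<exists>f'. (\<forall>t. (f has_vector_derivative f' t) (at t)) \<and> Ck n f')"

lemma Ck_SucI:
  "(\<And>t. (f has_vector_derivative f' t) (at t)) \<Longrightarrow> Ck n f' \<Longrightarrow> Ck (Suc n) f"
  by auto

lemma Ck_SucE:
  assumes "Ck (Suc n) f"
  obtains f' where "\<And>t. (f has_vector_derivative f' t) (at t)" "Ck n f'"
  using assms by auto

declare Ck.simps(2)[simp del]

lemma Ck_Suc_imp: "Ck (Suc n) f \<Longrightarrow> Ck n f"
proof (induction n arbitrary: f)
  case (Suc n)
  from Suc.prems obtain f' where "\<And>t. (f has_vector_derivative f' t) (at t)" "Ck (Suc n) f'"
    unfolding Ck.simps(2)[of "Suc n"] by blast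
  with Suc.IH show ?case by (intro Ck_SucI) blast+
qed simp

lemma Ck_bounded_linear:
  assumes "bounded_linear L" "Ck n f" shows "Ck n (\<lambda>t. L (f t))"
  using assms(2)
proof (induction n arbitrary: f)
  case (Suc n)
  from Suc.prems show ?case
    by (elim Ck_SucE)
       (intro Ck_SucI[OF bounded_linear.has_vector_derivative[OF assms(1)]] Suc.IH)
qed simp

lemma Ck_const: "Ck n (\<lambda>t. c)"
proof (induction n arbitrary: c)
  case (Suc n)
  show ?case by (intro Ck_SucI[OF has_vector_derivative_const] Suc)
qed simp

lemma Ck_add:
  assumes "Ck n f" "Ck n g" shows "Ck n (\<lambda>t. f t + g t)"
  using assms
proof (induction n arbitrary: f g)
  case (Suc n)
  from Suc.prems show ?case
    by (elim Ck_SucE) (intro Ck_SucI[OF has_vector_derivative_add] Suc.IH)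
qed simp

lemma Ck_mult:
  fixes f g :: "real \<Rightarrow> real"
  assumes "Ck n f" "Ck n g" shows "Ck n (\<lambda>t. f t * g t)"
  using assms
proof (induction n arbitrary: f g)
  case (Suc n)
  note lower = Suc.prems[THEN Ck_Suc_imp]
  from Suc.prems lower show ?case
    by (elim Ck_SucE) (intro Ck_SucI[OF has_vector_derivative_mult] Ck_add Suc.IH)
qed simp

lemma Ck_compose:
  fixes f g :: "real \<Rightarrow> real"
  assumes "Ck n f" "Ck n g" shows "Ck n (\<lambda>t. f (g t))"
  using assms
proof (induction n arbitrary: f g)
  case (Suc n)
  note lower = Suc.prems[THEN Ck_Suc_imp]
  from Suc.prems(1) obtain f' where f': "\<And>t. (f has_vector_derivative f' t) (at t)" "Ck n f'"
    unfolding Ck.simps(2) by blast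
  from Suc.prems(2) obtain g' where g': "\<And>t. (g has_vector_derivative g' t) (at t)" "Ck n g'"
    unfolding Ck.simps(2) by blast
  have "((\<lambda>t. f (g t)) has_vector_derivative g' t * f' (g t)) (at t)" for t
    using vector_diff_chain_at[OF g'(1) f'(1), of t] by (simp add: o_def)
  then show ?case
    by (rule Ck_SucI[OF _ Ck_mult[OF g'(2) Suc.IH[OF f'(2) lower(2)]]])
qed simp

text \<open>
  Derivatives are unique, so the derivatives provided for the different \<open>n\<close> are one and the same
  function; it is again \<open>n\<close> times differentiable for every \<open>n\<close>, which closes the coinduction.
\<close>

lemma smooth_on_UNIV_if_Ck:
  fixes f :: "real \<Rightarrow> 'b::real_normed_vector"
  assumes "\<And>n. Ck n f" shows "smooth_on UNIV f"
proof -
  have "\<forall>n. Ck n f" using assms by blast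
  then show ?thesis
  proof (coinduction arbitrary: f)
    case (smooth_on f)
    from smooth_on have "Ck (Suc 0) f" by blast
    then obtain f' where f': "\<And>t. (f has_vector_derivative f' t) (at t)"
      unfolding Ck.simps(2) by blast
    have "Ck n f'" for n
    proof -
      from smooth_on have "Ck (Suc n) f" by blast
      then obtain g where g: "\<And>t. (f has_vector_derivative g t) (at t)" "Ck n g"
        unfolding Ck.simps(2) by blast
      have "g = f'" using f' g(1) vector_derivative_unique_at by blast
      with g(2) show ?thesis by simp
    qed
    then have "Ck n (\<lambda>t. h *\<^sub>R f' t)" for n h
      by (intro Ck_bounded_linear[OF bounded_linear_scaleR_right])
    then show ?case
      using f' by (intro exI[of _ f] exI[of _ "\<lambda>t h. h *\<^sub>R f' t"])
        (simp add: has_vector_derivative_def)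
  qed
qed

lemma Ck_linear: "Ck n (\<lambda>t. c * t :: real)"
proof (cases n)
  case (Suc m)
  have "((\<lambda>t. c * t) has_vector_derivative c) (at t)" for t :: real
    by (auto intro!: derivative_eq_intros simp: has_real_derivative_iff_has_vector_derivative[symmetric])
  then show ?thesis unfolding Suc by (rule Ck_SucI) (rule Ck_const)
qed simp

lemma Ck_sin_cos: "Ck n (sin :: real \<Rightarrow> real) \<and> Ck n (cos :: real \<Rightarrow> real)"
proof (induction n)
  case (Suc n)
  have "Ck n (\<lambda>t::real. - sin t)"
    using Ck_bounded_linear[OF bounded_linear_minus[OF bounded_linear_ident], of n sin] Suc by blast
  moreover have "(sin has_vector_derivative cos t) (at t)" "(cos has_vector_derivative - sin t) (at t)" for t :: real
    by (auto intro!: derivative_eq_intros simp: has_real_derivative_iff_has_vector_derivative[symmetric])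
  ultimately show ?case
    using Suc by (simp add: Ck_SucI[of sin cos] Ck_SucI[of cos "\<lambda>t. - sin t"])
qed simp

text \<open>
  For \<open>p = 1\<close> this is the standard smooth function \<open>exp (- 1 / x)\<close> continued
  by \<open>0\<close> to \<open>x \<le> 0\<close>. The factor \<open>p (1 / x)\<close> makes the
  family closed under differentiation.
\<close>

definition flat :: "real poly \<Rightarrow> real \<Rightarrow> real" where
  "flat p x = (if x > 0 then poly p (1 / x) * exp (- (1 / x)) else 0)"

text \<open>
  In terms of \<open>y = 1 / x\<close> the exponential beats the polynomial \<open>p\<close> as \<open>y\<close> tends to
  infinity.
\<close>

lemma flat_tendsto_0: "(flat p \<longlongrightarrow> 0) (at_right 0)"
proof -
  have *: "((\<lambda>y. poly p y * exp (- y)) \<longlongrightarrow> 0) at_top"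
  proof -
    have "((\<lambda>y. \<Sum>i\<le>degree p. coeff p i * (y ^ i / exp y)) \<longlongrightarrow> (\<Sum>i\<le>degree p. coeff p i * 0)) at_top"
      by (intro tendsto_intros tendsto_power_div_exp_0)
    then show ?thesis
      by (simp add: poly_altdef exp_minus field_simps sum_divide_distrib)
  qed
  have "((\<lambda>x. poly p (1 / x) * exp (- (1 / x))) \<longlongrightarrow> 0) (at_right 0)"
    using filterlim_compose[OF * filterlim_inverse_at_top_right] by (simp add: field_simps)
  then show ?thesis
    by (rule Lim_transform_eventually) (auto simp: eventually_at_filter flat_def)
qed

text \<open>
  Only \<open>x = 0\<close> needs care. There the difference quotient is \<open>flat p x / x\<close>, which is
  again a member of the family and hence tends to \<open>0\<close>.
\<close>

lemma flat_has_derivative: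
  "(flat p has_vector_derivative flat (monom 1 2 * (p - pderiv p)) x) (at x)"
proof (cases "x = 0")
  case False
  consider "x > 0" | "x < 0" using False by linarith
  then show ?thesis
  proof cases
    case 1
    have "((\<lambda>x. poly p (1 / x) * exp (- (1 / x))) has_real_derivative
        (poly p (1/x) - poly (pderiv p) (1/x)) / x\<^sup>2 * exp (- (1/x))) (at x)"
      using 1 by (auto intro!: derivative_eq_intros simp: field_simps power2_eq_square)
    then have "(flat p has_real_derivative
        (poly p (1/x) - poly (pderiv p) (1/x)) / x\<^sup>2 * exp (- (1/x))) (at x)"
      by (rule has_field_derivative_transform_within_open[of _ _ _ "{0<..}"])
         (use 1 in \<open>auto simp: flat_def\<close>)
    then show ?thesis
      using 1 by (simp add: has_real_derivative_iff_has_vector_derivative flat_def poly_monom field_simps)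
  next
    case 2
    have "((\<lambda>x. 0) has_real_derivative 0) (at x)" by simp
    then have "(flat p has_real_derivative 0) (at x)"
      by (rule has_field_derivative_transform_within_open[of _ _ _ "{..<0}"])
         (use 2 in \<open>auto simp: flat_def\<close>)
    then show ?thesis
      using 2 by (simp add: has_real_derivative_iff_has_vector_derivative flat_def)
  qed
next
  case True
  have "((\<lambda>h. (flat p (0 + h) - flat p 0) / h) \<longlongrightarrow> 0) (at_right 0)"
    by (rule Lim_transform_eventually[OF flat_tendsto_0[of "monom 1 1 * p"]])
       (auto simp: eventually_at_filter flat_def poly_monom)
  moreover have "((\<lambda>h. (flat p (0 + h) - flat p 0) / h) \<longlongrightarrow> 0) (at_left 0)"
    by (rule Lim_transform_eventually[OF tendsto_const])
       (auto simp: eventually_at_filter flat_def)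
  ultimately have "(flat p has_real_derivative 0) (at 0)"
    by (simp add: DERIV_def filterlim_split_at)
  then show ?thesis
    using True by (simp add: has_real_derivative_iff_has_vector_derivative flat_def)
qed

lemma Ck_flat: "Ck n (flat p)"
proof (induction n arbitrary: p)
  case (Suc n)
  then show ?case by (intro Ck_SucI[OF flat_has_derivative])
qed simp

section \<open>Crossings between the first two components\<close>

lemma det2_linear:
  assumes "linear L"
  shows "det2 (L u) (L v) = det2 (L 1) (L \<i>) * det2 u v"
proof -
  have L: "L w = Re w *\<^sub>R L 1 + Im w *\<^sub>R L \<i>" for w
  proof -
    have "w = Re w *\<^sub>R 1 + Im w *\<^sub>R \<i>" by (simp add: complex_eq_iff)
    then have "L w = L (Re w *\<^sub>R 1 + Im w *\<^sub>R \<i>)" by simp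
    then show ?thesis by (simp add: linear_add[OF assms] linear_scale[OF assms])
  qed
  show ?thesis
    unfolding L[of u] L[of v] det2_def by (simp add: algebra_simps)
qed

lemma smooth_on_has_vector_derivative:
  assumes "smooth_on UNIV \<gamma>"
  shows "(\<gamma> has_vector_derivative vector_derivative \<gamma> (at t)) (at t)"
proof -
  obtain f' where "(\<gamma> has_derivative f') (at t)"
    using smooth_on_derivative[OF assms] by auto
  then have "\<gamma> differentiable at t" by (auto simp: differentiable_def)
  then show ?thesis by (simp add: vector_derivative_works)
qed

context
  fixes D assumes D: "is_diagram D"
begin

lemma diagram_smooth: "i < length (curves D) \<Longrightarrow> smooth_on UNIV (curves D ! i)"
  using D by (simp add: is_diagram_def)

lemma diagram_has_derivative:
  "i < length (curves D) \<Longrightarrow> ((curves D ! i) has_vector_derivative direction D (i, t)) (at t)"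
  using smooth_on_has_vector_derivative[OF diagram_smooth] by simp

lemma diagram_continuous: "i < length (curves D) \<Longrightarrow> continuous_on S (curves D ! i)"
  by (meson continuous_on_subset diagram_smooth smooth_on_imp_continuous_on subset_UNIV)

lemma position_shift:
  assumes "i < length (curves D)"
  shows "position D (i, t + of_int m) = position D (i, t)"
proof -
  have p: "(curves D ! i) (t + 1) = (curves D ! i) t" for t
    using D assms by (simp add: is_diagram_def)
  have n: "(curves D ! i) (t + of_nat n) = (curves D ! i) t" for t n
  proof (induction n)
    case (Suc n)
    then show ?case using p[of "t + of_nat n"] by (simp add: algebra_simps)
  qed simp
  show ?thesis
  proof (cases "m \<ge> 0")
    case True
    then show ?thesis using n[of t "nat m"] by simp
  next
    case False
    then show ?thesis using n[of "t + of_int m" "nat (- m)"] by simp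
  qed
qed

lemma direction_shift:
  assumes "i < length (curves D)"
  shows "direction D (i, t + of_int m) = direction D (i, t)"
proof -
  have "((\<lambda>x. x + of_int m) has_vector_derivative 1) (at t)"
    by (auto intro!: derivative_eq_intros simp: has_real_derivative_iff_has_vector_derivative[symmetric])
  then have "((curves D ! i \<circ> (\<lambda>x. x + of_int m)) has_vector_derivative
      1 *\<^sub>R direction D (i, t + of_int m)) (at t)"
    using diagram_has_derivative[OF assms] by (rule vector_diff_chain_at)
  moreover have "curves D ! i \<circ> (\<lambda>x. x + of_int m) = curves D ! i"
    using position_shift[OF assms] by (simp add: fun_eq_iff)
  ultimately have "((curves D ! i) has_vector_derivative direction D (i, t + of_int m)) (at t)"
    by simp
  then show ?thesis
    using diagram_has_derivative[OF assms, of t] vector_derivative_unique_at by blast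
qed

lemma double_pair_over: "double_pair D p q \<Longrightarrow> p \<in> over D \<longleftrightarrow> q \<notin> over D"
  using D unfolding is_diagram_def by blast

lemma double_pair_transversal:
  "double_pair D p q \<Longrightarrow> det2 (direction D p) (direction D q) \<noteq> 0"
  using D unfolding is_diagram_def by blast

lemma double_pair_shift:
  "double_pair D (i, s + of_int m) (j, t + of_int n) \<longleftrightarrow> double_pair D (i, s) (j, t)"
proof -
  have "s + of_int m - (t + of_int n) \<in> \<int> \<longleftrightarrow> s - t \<in> \<int>"
  proof -
    have "s + of_int m - (t + of_int n) = (s - t) + of_int (m - n)" by simp
    then show ?thesis by (metis Ints_add Ints_diff Ints_of_int add_diff_cancel_right')
  qed
  then show ?thesis
    by (auto simp: double_pair_def points_def position_shift simp del: position.simps)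
qed

text \<open>
  Being over is not required to be periodic in the parameter, but it is: all translates of a point
  have the same partner at a double point, and this partner is over exactly if they are not.
\<close>

lemma crossing_shift:
  "crossing D (i, s + of_int m) (j, t + of_int n) \<longleftrightarrow> crossing D (i, s) (j, t)"
proof -
  have "(i, s + of_int m) \<in> over D \<longleftrightarrow> (i, s) \<in> over D" if d: "double_pair D (i, s) (j, t)"
  proof -
    have "double_pair D (i, s + of_int m) (j, t)"
      using d double_pair_shift[of i s m j t 0] by simp
    then show ?thesis using d double_pair_over by blast
  qed
  then show ?thesis by (auto simp: crossing_def double_pair_shift)
qed

lemma crossing_sign_shift:
  assumes "crossing D (i, s) (j, t)"
  shows "crossing_sign D (i, s + of_int m) (j, t + of_int n) = crossing_sign D (i, s) (j, t)"
  using assms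
  by (auto simp: crossing_def double_pair_def points_def crossing_sign_def direction_shift
      simp del: direction.simps)

lemma not_crossing_both: "crossing D p q \<Longrightarrow> \<not> crossing D q p"
  using double_pair_over unfolding crossing_def by blast

lemma no_triple_point:
  "double_pair D p q \<Longrightarrow> double_pair D q r \<Longrightarrow> double_pair D p r \<Longrightarrow> False"
  using D unfolding is_diagram_def by blast

end

text \<open>
  Component \<open>0\<close> runs over component \<open>1\<close>, and \<open>k\<close> is the component that is followed:
  \<open>u\<close> is a parameter on component \<open>k\<close> and \<open>v\<close> one on the other component. So
  \<open>k = 0\<close> follows the over-strand of the crossing and \<open>k = 1\<close> the under-strand. Crossings
  at which component \<open>1\<close> is over are disregarded.
\<close>

definition meets :: "nat \<Rightarrow> sign \<Rightarrow> diagram \<Rightarrow> real \<Rightarrow> real \<Rightarrow> bool" where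
  "meets k e D u v \<longleftrightarrow>
     (if k = 0 then crossing D (0, u) (1, v) \<and> crossing_sign D (0, u) (1, v) = e
      else crossing D (0, v) (1, u) \<and> crossing_sign D (0, v) (1, u) = e)"

definition passages :: "nat \<Rightarrow> sign \<Rightarrow> diagram \<Rightarrow> real set" where
  "passages k e D = {u. \<exists>v. meets k e D u v}"

lemma meets_shift:
  assumes "is_diagram D"
  shows "meets k e D (u + of_int m) (v + of_int n) \<longleftrightarrow> meets k e D u v"
  using crossing_shift[OF assms] crossing_sign_shift[OF assms]
  unfolding meets_def by metis

lemma passages_shift:
  assumes "is_diagram D"
  shows "u + of_int m \<in> passages k e D \<longleftrightarrow> u \<in> passages k e D"
proof -
  have "(\<exists>v. meets k e D (u + of_int m) v) \<longleftrightarrow> (\<exists>v. meets k e D u v)"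
    using meets_shift[OF assms, of k e u m _ 0] by simp
  then show ?thesis by (simp add: passages_def)
qed

lemma meets_double_pair:
  assumes "meets k e D u v" "k \<le> 1"
  shows "double_pair D (k, u) (1 - k, v)"
  using assms by (auto simp: meets_def crossing_def double_pair_def le_Suc_eq split: if_splits)

text \<open>
  Transversality says that \<open>(s, t) \<mapsto> \<gamma> s - \<delta> t\<close> has an injective derivative at the double
  point. The difference then grows at least linearly with the distance from the double point.
\<close>

lemma double_points_isolated:
  fixes \<gamma> \<delta> :: "real \<Rightarrow> complex"
  assumes "(\<gamma> has_vector_derivative \<gamma>') (at s)" "(\<delta> has_vector_derivative \<delta>') (at t)"
    and "\<gamma> s = \<delta> t" and "det2 \<gamma>' \<delta>' \<noteq> 0"
  shows "\<not> (s, t) islimpt {(s, t). \<gamma> s = \<delta> t}"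
proof -
  define F where "F = (\<lambda>x. \<gamma> (fst x) - \<delta> (snd x))"
  \<comment> \<open>the derivative of \<open>F\<close> at \<open>(s, t)\<close>\<close>
  define F' where "F' = (\<lambda>h :: real \<times> real. fst h *\<^sub>R \<gamma>' - snd h *\<^sub>R \<delta>')"
  have der: "(F has_derivative F') (at (s, t))"
  proof -
    have "((\<lambda>x. \<gamma> (fst x)) has_derivative (\<lambda>h. fst h *\<^sub>R \<gamma>')) (at (s, t))"
      using assms(1) has_derivative_compose[OF has_derivative_fst[OF has_derivative_ident], of \<gamma> _ "(s, t)"]
      by (simp add: has_vector_derivative_def)
    moreover have "((\<lambda>x. \<delta> (snd x)) has_derivative (\<lambda>h. snd h *\<^sub>R \<delta>')) (at (s, t))"
      using assms(2) has_derivative_compose[OF has_derivative_snd[OF has_derivative_ident], of \<delta> _ "(s, t)"]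
      by (simp add: has_vector_derivative_def)
    ultimately show ?thesis unfolding F_def F'_def by (rule has_derivative_diff)
  qed
  have lin: "linear F'" using der has_derivative_linear by blast
  have "inj F'"
    unfolding linear_injective_0[OF lin]
  proof (intro allI impI)
    fix h assume "F' h = 0"
    then have eq: "fst h *\<^sub>R \<gamma>' = snd h *\<^sub>R \<delta>'" by (simp add: F'_def)
    then have "fst h * Re \<gamma>' = snd h * Re \<delta>'" "fst h * Im \<gamma>' = snd h * Im \<delta>'"
      by (auto simp: complex_eq_iff)
    then have "fst h * det2 \<gamma>' \<delta>' = 0" "snd h * det2 \<gamma>' \<delta>' = 0"
      unfolding det2_def by algebra+
    then show "h = 0" using assms(4) by (simp add: prod_eq_iff)
  qed
  then obtain B where B: "B > 0" "\<And>x. B * norm x \<le> norm (F' x)"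
    using linear_inj_bounded_below_pos[OF lin] by blast
  obtain d where d: "d > 0" "\<And>y. norm (y - (s, t)) < d \<Longrightarrow>
      norm (F y - F (s, t) - F' (y - (s, t))) \<le> B / 2 * norm (y - (s, t))"
    using der B(1) unfolding has_derivative_at_alt by (metis half_gt_zero)
  show ?thesis
  proof
    assume "(s, t) islimpt {(s, t). \<gamma> s = \<delta> t}"
    then obtain y where y: "F y = 0" "y \<noteq> (s, t)" "dist y (s, t) < d"
      using d(1) unfolding islimpt_approachable F_def by fastforce
    have "norm (F' (y - (s, t))) \<le> B / 2 * norm (y - (s, t))"
      using d(2)[of y] y assms(3) by (simp add: dist_norm F_def)
    with B(2)[of "y - (s, t)"] have "B * norm (y - (s, t)) \<le> B / 2 * norm (y - (s, t))"
      by linarith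
    with B(1) y(2) show False by simp
  qed
qed

text \<open>
  Modulo periods the other parameter of a crossing can be taken in \<open>{0..1}\<close>, so the crossings in
  question are the zeros of a continuous function on a rectangle, and they are isolated. Without
  finiteness, counting passages by \<^const>\<open>card\<close> would be meaningless.
\<close>

lemma finite_passages:
  assumes D: "is_diagram D" and k: "k \<le> 1"
  shows "finite (passages k e D \<inter> {x..y})"
proof (cases "length (curves D) \<ge> 2")
  case False
  then have "passages k e D = {}"
    by (auto simp: passages_def meets_def crossing_def double_pair_def points_def split: if_splits)
  then show ?thesis by simp
next
  case True
  then have len: "k < length (curves D)" "1 - k < length (curves D)" using k by auto
  have ne: "k \<noteq> 1 - k" by arith
  define Z where "Z = {(u, v). (curves D ! k) u = (curves D ! (1 - k)) v}"
  have isol: "\<not> z islimpt Z" for z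
  proof (cases "z \<in> Z")
    case True
    then obtain u v where z: "z = (u, v)" "(curves D ! k) u = (curves D ! (1 - k)) v"
      by (auto simp: Z_def)
    then have "double_pair D (k, u) (1 - k, v)"
      using len ne by (simp add: double_pair_def points_def)
    then show ?thesis
      unfolding z(1) Z_def
      by (intro double_points_isolated[OF diagram_has_derivative[OF D len(1)]
            diagram_has_derivative[OF D len(2)] z(2)] double_pair_transversal[OF D])
  next
    case False
    have "closed Z"
      unfolding Z_def case_prod_unfold
      by (intro closed_Collect_eq continuous_on_compose2[OF diagram_continuous[OF D]] len
          continuous_intros) auto
    with False show ?thesis using closed_limpt by blast
  qed
  have "finite (({x..y} \<times> {0..1}) \<inter> Z)"
    by (intro finite_not_islimpt_in_compact isol compact_Times compact_Icc)
  moreover have "passages k e D \<inter> {x..y} \<subseteq> fst ` (({x..y} \<times> {0..1}) \<inter> Z)"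
  proof
    fix u assume u: "u \<in> passages k e D \<inter> {x..y}"
    then obtain v where "meets k e D u v" by (auto simp: passages_def)
    then have "meets k e D (u + of_int 0) (v + of_int (- \<lfloor>v\<rfloor>))"
      using meets_shift[OF D] by blast
    then have "double_pair D (k, u) (1 - k, frac v)"
      using meets_double_pair[OF _ k] by (simp add: frac_def)
    then have "(u, frac v) \<in> ({x..y} \<times> {0..1}) \<inter> Z"
      using u frac_ge_0[of v] frac_lt_1[of v] by (simp add: double_pair_def Z_def)
    then show "u \<in> fst ` (({x..y} \<times> {0..1}) \<inter> Z)"
      by (rule image_eqI[rotated]) simp
  qed
  ultimately show ?thesis by (meson finite_imageI finite_subset)
qed

text \<open>
  The condition of the ballot problem: when the parameter runs from \<open>a\<close> to \<open>b\<close>, the elements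
  of \<open>N\<close> never outnumber the elements of \<open>P\<close> met so far.
\<close>

definition ballot :: "real set \<Rightarrow> real set \<Rightarrow> real \<Rightarrow> real \<Rightarrow> bool" where
  "ballot P N a b \<longleftrightarrow> (\<forall>s \<in> {a..b}. card (N \<inter> {a..<s}) \<le> card (P \<inter> {a..<s}))"

text \<open>
  The base point is a point \<open>z\<close> of the plane and not a parameter. If \<open>z\<close> lies outside the
  changing disk then it stays on the curve in the course of all moves, whereas reparametrizations
  change its parameter. A base point is indispensable, because \<open>+ -\<close> and \<open>- +\<close> are the same
  cyclic word.
\<close>

definition based_ballot :: "nat \<Rightarrow> complex \<Rightarrow> diagram \<Rightarrow> bool" where
  "based_ballot k z D \<longleftrightarrow> 2 \<le> length (curves D) \<and>
     (\<exists>\<tau>. position D (k, \<tau>) = z \<and> ballot (passages k Pos D) (passages k Neg D) \<tau> (\<tau> + 1))"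

text \<open>
  An initial segment that ends before \<open>a\<close> is not affected by the exchange. If it ends inside
  \<open>{a..b}\<close>, it is an old initial segment followed by a part of the new piece, neither of which
  has a deficit. If it ends after \<open>b\<close>, its total is the same as before the exchange.
\<close>

lemma ballot_replace:
  assumes fin: "\<And>x y. finite (P \<inter> {x..y})" "\<And>x y. finite (N \<inter> {x..y})"
      "\<And>x y. finite (P' \<inter> {x..y})" "\<And>x y. finite (N' \<inter> {x..y})"
    and out: "\<And>u. u \<in> {\<tau>..\<tau>'} - {a..b} \<Longrightarrow> (u \<in> P \<longleftrightarrow> u \<in> P') \<and> (u \<in> N \<longleftrightarrow> u \<in> N')"
    and bal: "ballot P N \<tau> \<tau>'" "ballot P' N' a b"
    and tot: "card (P \<inter> {a..b}) + card (N' \<inter> {a..b}) = card (P' \<inter> {a..b}) + card (N \<inter> {a..b})"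
    and ab: "\<tau> < a" "a \<le> b" "b < \<tau>'"
  shows "ballot P' N' \<tau> \<tau>'"
  unfolding ballot_def
proof
  fix s assume s: "s \<in> {\<tau>..\<tau>'}"
  have P_eq: "P' \<inter> X = P \<inter> X" and N_eq: "N' \<inter> X = N \<inter> X" if "X \<subseteq> {\<tau>..\<tau>'} - {a..b}" for X
    using out that by blast+
  have split2: "card (Q \<inter> {\<tau>..<s}) = card (Q \<inter> {\<tau>..<a}) + card (Q \<inter> {a..<s})"
    if "finite (Q \<inter> {\<tau>..\<tau>'})" "a < s" for Q
  proof -
    have "Q \<inter> {\<tau>..<s} = (Q \<inter> {\<tau>..<a}) \<union> (Q \<inter> {a..<s})" using that(2) ab by auto
    moreover have "finite (Q \<inter> {\<tau>..<a})" "finite (Q \<inter> {a..<s})"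
      using that s ab by (auto elim!: finite_subset[rotated])
    ultimately show ?thesis by (metis card_Un_disjoint Int_assoc Int_commute Int_empty_right Int_left_commute ivl_disj_int_two(3))
  qed
  have split3: "card (Q \<inter> {\<tau>..<s}) = card (Q \<inter> {\<tau>..<a}) + card (Q \<inter> {a..b}) + card (Q \<inter> {b<..<s})"
    if "finite (Q \<inter> {\<tau>..\<tau>'})" "b < s" for Q
  proof -
    have "Q \<inter> {a..<s} = (Q \<inter> {a..b}) \<union> (Q \<inter> {b<..<s})" using that(2) ab by auto
    moreover have "finite (Q \<inter> {a..b})" "finite (Q \<inter> {b<..<s})"
      using that s ab by (auto elim!: finite_subset[rotated])
    moreover have "(Q \<inter> {a..b}) \<inter> (Q \<inter> {b<..<s}) = {}" by auto
    ultimately have "card (Q \<inter> {a..<s}) = card (Q \<inter> {a..b}) + card (Q \<inter> {b<..<s})"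
      by (simp add: card_Un_disjoint)
    then show ?thesis using split2 that ab by simp
  qed
  note fT = fin[of \<tau> \<tau>']
  consider "s \<le> a" | "a < s" "s \<le> b" | "b < s" by linarith
  then show "card (N' \<inter> {\<tau>..<s}) \<le> card (P' \<inter> {\<tau>..<s})"
  proof cases
    case 1
    then have "{\<tau>..<s} \<subseteq> {\<tau>..\<tau>'} - {a..b}" using s by auto
    then show ?thesis using P_eq N_eq bal(1) s by (simp add: ballot_def)
  next
    case 2
    have "{\<tau>..<a} \<subseteq> {\<tau>..\<tau>'} - {a..b}" using ab by auto
    then have "card (N' \<inter> {\<tau>..<a}) \<le> card (P' \<inter> {\<tau>..<a})"
      using P_eq N_eq bal(1) ab by (simp add: ballot_def)
    moreover have "card (N' \<inter> {a..<s}) \<le> card (P' \<inter> {a..<s})"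
      using bal(2) 2 by (simp add: ballot_def)
    ultimately show ?thesis using split2 fT 2 by simp
  next
    case 3
    have sub: "{\<tau>..<a} \<subseteq> {\<tau>..\<tau>'} - {a..b}" "{b<..<s} \<subseteq> {\<tau>..\<tau>'} - {a..b}" using ab s by auto
    have "card (N \<inter> {\<tau>..<s}) \<le> card (P \<inter> {\<tau>..<s})" using bal(1) s by (simp add: ballot_def)
    then show ?thesis
      using tot split3[of P] split3[of N] split3[of P'] split3[of N'] fT 3
      by (simp add: P_eq[OF sub(1)] P_eq[OF sub(2)] N_eq[OF sub(1)] N_eq[OF sub(2)])
  qed
qed

section \<open>Exchanging the arcs inside a disk\<close>

text \<open>
  The arc is determined only up to integer translations. As it does not contain the base point, one
  of its translates lies strictly inside the period that starts there.
\<close>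

lemma ballot_replace_periodic:
  assumes fin: "\<And>x y. finite (P \<inter> {x..y})" "\<And>x y. finite (N \<inter> {x..y})"
      "\<And>x y. finite (P' \<inter> {x..y})" "\<And>x y. finite (N' \<inter> {x..y})"
    and per: "\<And>u m. u + of_int m \<in> P \<longleftrightarrow> u \<in> P" "\<And>u m. u + of_int m \<in> N \<longleftrightarrow> u \<in> N"
      "\<And>u m. u + of_int m \<in> P' \<longleftrightarrow> u \<in> P'" "\<And>u m. u + of_int m \<in> N' \<longleftrightarrow> u \<in> N'"
    and out: "\<And>u. (k, u) \<notin> arc_points (k, a, b) \<Longrightarrow> (u \<in> P \<longleftrightarrow> u \<in> P') \<and> (u \<in> N \<longleftrightarrow> u \<in> N')"
    and bal: "ballot P N \<tau> (\<tau> + 1)" "ballot P' N' a b"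
    and tot: "card (P \<inter> {a..b}) + card (N' \<inter> {a..b}) = card (P' \<inter> {a..b}) + card (N \<inter> {a..b})"
    and ab: "a < b" "b < a + 1" "(k, \<tau>) \<notin> arc_points (k, a, b)"
  shows "ballot P' N' \<tau> (\<tau> + 1)"
proof -
  \<comment> \<open>translates the start of the arc into the period that begins at \<open>\<tau>\<close>\<close>
  define m where "m = \<lceil>\<tau> - a\<rceil>"
  have m: "\<tau> \<le> a + m" "a + m < \<tau> + 1"
    unfolding m_def by linarith+
  have \<tau>: "\<not> (a \<le> \<tau> - of_int n \<and> \<tau> - of_int n \<le> b)" for n
  proof
    assume "a \<le> \<tau> - of_int n \<and> \<tau> - of_int n \<le> b"
    then have "\<exists>t j. \<tau> = t + of_int j \<and> a \<le> t \<and> t \<le> b"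
      by (intro exI[of _ "\<tau> - of_int n"] exI[of _ n]) auto
    then show False using ab(3) by simp
  qed
  have a': "\<tau> < a + m" using \<tau>[of m] m ab by (cases "\<tau> = a + m") auto
  have b': "b + m < \<tau> + 1" using \<tau>[of "m - 1"] m ab by auto
  have card_shift: "card A = card B" if "\<And>u. u \<in> A \<longleftrightarrow> u - of_int m \<in> B" for A B :: "real set"
  proof -
    have "u \<in> A \<longleftrightarrow> u \<in> (\<lambda>u. u + of_int m) ` B" for u
      unfolding that[of u] image_iff by (metis add_diff_cancel_right' diff_add_cancel)
    then have "A = (\<lambda>u. u + of_int m) ` B" by blast
    then show ?thesis by (simp add: card_image inj_on_def)
  qed
  have shift: "card (Q \<inter> {x + of_int m..y + of_int m}) = card (Q \<inter> {x..y})"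
    "card (Q \<inter> {x + of_int m..<y + of_int m}) = card (Q \<inter> {x..<y})"
    if "\<And>u m. u + of_int m \<in> Q \<longleftrightarrow> u \<in> Q" for x y and Q :: "real set"
  proof -
    have Q: "u \<in> Q \<longleftrightarrow> u - of_int m \<in> Q" for u
      using that[of "u - of_int m" m] by simp
    show "card (Q \<inter> {x + of_int m..y + of_int m}) = card (Q \<inter> {x..y})"
      by (rule card_shift) (use Q in auto)
    show "card (Q \<inter> {x + of_int m..<y + of_int m}) = card (Q \<inter> {x..<y})"
      by (rule card_shift) (use Q in auto)
  qed
  show ?thesis
  proof (rule ballot_replace[OF fin, where a = "a + m" and b = "b + m"])
    fix u assume u: "u \<in> {\<tau>..\<tau> + 1} - {a + m..b + m}"
    have "(k, u) \<notin> arc_points (k, a, b)"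
    proof
      assume "(k, u) \<in> arc_points (k, a, b)"
      then obtain t n where t: "u = t + of_int n" "a \<le> t" "t \<le> b" by auto
      consider "n = m" | "of_int n \<le> real_of_int m - 1" | "of_int n \<ge> real_of_int m + 1"
        by linarith
      then show False using t u a' b' by cases auto
    qed
    then show "(u \<in> P \<longleftrightarrow> u \<in> P') \<and> (u \<in> N \<longleftrightarrow> u \<in> N')" by (rule out)
  next
    show "ballot P' N' (a + m) (b + m)"
      unfolding ballot_def
    proof
      fix s assume s: "s \<in> {a + m..b + m}"
      then have "s - m \<in> {a..b}" by auto
      then have "card (N' \<inter> {a..<s - m}) \<le> card (P' \<inter> {a..<s - m})"
        using bal(2) unfolding ballot_def by blast
      then show "card (N' \<inter> {a + m..<s}) \<le> card (P' \<inter> {a + m..<s})"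
        using shift(2)[OF per(3), of a "s - m"] shift(2)[OF per(4), of a "s - m"] by simp
    qed
  next
    show "card (P \<inter> {a + m..b + m}) + card (N' \<inter> {a + m..b + m}) =
        card (P' \<inter> {a + m..b + m}) + card (N \<inter> {a + m..b + m})"
      using tot by (simp add: shift per)
  qed (use bal a' b' ab in auto)
qed

lemma arc_points_shift: "(k, u + of_int m) \<in> arc_points A \<longleftrightarrow> (k, u) \<in> arc_points A"
proof -
  obtain i a b where A: "A = (i, a, b)" by (cases A)
  have "(k, u + of_int m) \<in> arc_points A" if "(k, u) \<in> arc_points A" for u m
  proof -
    from that obtain t n where "u = t + of_int n" "a \<le> t" "t \<le> b" "k = i" by (auto simp: A)
    then show ?thesis
      unfolding A by (auto intro!: exI[of _ t] exI[of _ "n + m"])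
  qed
  from this[of u m] this[of "u + of_int m" "- m"] show ?thesis by auto
qed

text \<open>
  The arcs are exchanged one after the other. The intermediate stages are not the passages of any
  diagram, which is why this is a statement about sets of real numbers.
\<close>

lemma ballot_replace_arcs:
  assumes "\<And>x y. finite (P \<inter> {x..y})" "\<And>x y. finite (N \<inter> {x..y})"
    and fin': "\<And>x y. finite (P' \<inter> {x..y})" "\<And>x y. finite (N' \<inter> {x..y})"
    and "\<And>u m. u + of_int m \<in> P \<longleftrightarrow> u \<in> P" "\<And>u m. u + of_int m \<in> N \<longleftrightarrow> u \<in> N"
    and per': "\<And>u m. u + of_int m \<in> P' \<longleftrightarrow> u \<in> P'" "\<And>u m. u + of_int m \<in> N' \<longleftrightarrow> u \<in> N'"
    and "\<And>u. (k, u) \<notin> (\<Union>A \<in> set As. arc_points A) \<Longrightarrow> (u \<in> P \<longleftrightarrow> u \<in> P') \<and> (u \<in> N \<longleftrightarrow> u \<in> N')"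
    and "sorted_wrt (\<lambda>A B. disjnt (arc_points A) (arc_points B)) As"
    and "\<And>i a b. (i, a, b) \<in> set As \<Longrightarrow> a < b \<and> b < a + 1"
    and "\<And>a b. (k, a, b) \<in> set As \<Longrightarrow> ballot P' N' a b \<and>
      card (P \<inter> {a..b}) + card (N' \<inter> {a..b}) = card (P' \<inter> {a..b}) + card (N \<inter> {a..b})"
    and "(k, \<tau>) \<notin> (\<Union>A \<in> set As. arc_points A)"
    and "ballot P N \<tau> (\<tau> + 1)"
  shows "ballot P' N' \<tau> (\<tau> + 1)"
  using assms(1,2,5,6,9-)
proof (induction As arbitrary: P N)
  case Nil
  then have "P = P'" "N = N'" by auto
  with Nil show ?case by simp
next
  case (Cons A As)
  note fin = Cons.prems(1,2) and per = Cons.prems(3,4) and out = Cons.prems(5)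
    and disj = Cons.prems(6) and len = Cons.prems(7) and loc = Cons.prems(8)
    and \<tau> = Cons.prems(9) and bal = Cons.prems(10)
  obtain i a b where A: "A = (i, a, b)" by (cases A)
  \<comment> \<open>the stage at which only the arc \<open>A\<close> has been exchanged\<close>
  define mix where "mix = (\<lambda>Q' Q. {u. if (k, u) \<in> arc_points A then u \<in> Q' else u \<in> Q})"
  have mix_in: "mix Q' Q \<inter> X = Q' \<inter> X" if "\<And>u. u \<in> X \<Longrightarrow> (k, u) \<in> arc_points A" for Q' Q X
    using that by (auto simp: mix_def)
  have mix_out: "mix Q' Q \<inter> X = Q \<inter> X" if "\<And>u. u \<in> X \<Longrightarrow> (k, u) \<notin> arc_points A" for Q' Q X
    using that by (auto simp: mix_def)
  have fin_mix: "finite (mix Q' Q \<inter> {x..y})"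
    if "finite (Q' \<inter> {x..y})" "finite (Q \<inter> {x..y})" for Q' Q x y
    by (rule finite_subset[OF _ finite_UnI[OF that]]) (auto simp: mix_def)
  have per_mix: "u + of_int m \<in> mix Q' Q \<longleftrightarrow> u \<in> mix Q' Q"
    if "\<And>u m. u + of_int m \<in> Q \<longleftrightarrow> u \<in> Q" "\<And>u m. u + of_int m \<in> Q' \<longleftrightarrow> u \<in> Q'" for u m Q' Q
    using that by (simp add: mix_def arc_points_shift del: arc_points.simps)
  have inA: "(i, u) \<in> arc_points A" if "u \<in> {a..b}" for u
    unfolding A using that by (auto intro!: exI[of _ u] exI[of _ "0::int"])
  have step: "ballot (mix P' P) (mix N' N) \<tau> (\<tau> + 1)"
  proof (cases "i = k")
    case False
    then have "mix P' P = P" "mix N' N = N" by (auto simp: mix_def A)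
    then show ?thesis using bal by simp
  next
    case True
    have eq: "mix Q' Q \<inter> {a..b} = Q' \<inter> {a..b}" for Q' Q
      using inA True by (intro mix_in) auto
    have eq': "mix Q' Q \<inter> {a..<s} = Q' \<inter> {a..<s}" if "s \<le> b" for Q' Q s
      using inA True that by (intro mix_in) auto
    have locA: "ballot P' N' a b"
      "card (P \<inter> {a..b}) + card (N' \<inter> {a..b}) = card (P' \<inter> {a..b}) + card (N \<inter> {a..b})"
      using loc[of a b] True A by auto
    show ?thesis
    proof (rule ballot_replace_periodic[where a = a and b = b and k = k, OF fin fin_mix fin_mix
          per per_mix per_mix])
      show "ballot (mix P' P) (mix N' N) a b"
        using locA(1) eq' by (simp add: ballot_def)
      show "card (P \<inter> {a..b}) + card (mix N' N \<inter> {a..b}) =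
          card (mix P' P \<inter> {a..b}) + card (N \<inter> {a..b})"
        using locA(2) by (simp add: eq)
      show "(k, \<tau>) \<notin> arc_points (k, a, b)" using \<tau> A True by auto
      show "(u \<in> P \<longleftrightarrow> u \<in> mix P' P) \<and> (u \<in> N \<longleftrightarrow> u \<in> mix N' N)"
        if "(k, u) \<notin> arc_points (k, a, b)" for u
        using that A True by (simp add: mix_def del: arc_points.simps)
      show "a < b" "b < a + 1" using len[of i a b] A by auto
    qed (use fin fin' per per' bal in auto)
  qed
  show ?case
  proof (rule Cons.IH[of "mix P' P" "mix N' N"])
    show "(u \<in> mix P' P \<longleftrightarrow> u \<in> P') \<and> (u \<in> mix N' N \<longleftrightarrow> u \<in> N')"
      if "(k, u) \<notin> (\<Union>A \<in> set As. arc_points A)" for u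
      using that out[of u] by (simp add: mix_def)
    show "ballot P' N' c d \<and> card (mix P' P \<inter> {c..d}) + card (N' \<inter> {c..d}) =
        card (P' \<inter> {c..d}) + card (mix N' N \<inter> {c..d})" if B: "(k, c, d) \<in> set As" for c d
    proof -
      have "(k, u) \<notin> arc_points A" if "u \<in> {c..d}" for u
      proof -
        have "(k, u) \<in> arc_points (k, c, d)"
          using that by (auto intro!: exI[of _ u] exI[of _ "0::int"])
        then show ?thesis using disj B by (auto simp: disjnt_iff simp del: arc_points.simps)
      qed
      then have "mix Q' Q \<inter> {c..d} = Q \<inter> {c..d}" for Q' Q by (intro mix_out) auto
      then show ?thesis using loc[of c d] B by simp
    qed
    show "sorted_wrt (\<lambda>A B. disjnt (arc_points A) (arc_points B)) As" using disj by simp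
    show "\<And>i a b. (i, a, b) \<in> set As \<Longrightarrow> a < b \<and> b < a + 1" using len by auto
    show "(k, \<tau>) \<notin> (\<Union>A \<in> set As. arc_points A)" using \<tau> by auto
  qed (use fin fin' per per' fin_mix per_mix step in auto)
qed

lemma embedded_disk_closed: "embedded_disk C \<Longrightarrow> closed C"
  unfolding embedded_disk_def diffeo_def
  by (metis compact_cball compact_continuous_image compact_imp_closed continuous_on_subset
      smooth_on_imp_continuous_on subset_UNIV)

lemma replacement_sym: "replacement C As D E \<Longrightarrow> replacement C As E D"
  unfolding replacement_def points_def by auto

text \<open>
  Points with position outside the closed set \<open>C\<close> have a neighbourhood of such points, and there
  the two parametrizations coincide.
\<close>

lemma replacement_direction:
  assumes "replacement C As D E" "p \<in> points D" "position D p \<notin> C"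
  shows "direction E p = direction D p"
proof -
  obtain i t where p: "p = (i, t)" by (cases p)
  have len: "i < length (curves D)" using assms(2) p by (simp add: points_def)
  have D: "is_diagram D" and "closed C"
    and arcs: "{p \<in> points D. position D p \<in> C} = (\<Union>A \<in> set As. arc_points A)"
    and same: "\<forall>p \<in> points D - (\<Union>A \<in> set As. arc_points A). position E p = position D p"
    using assms(1) embedded_disk_closed unfolding replacement_def arcs_in_def by auto
  have op: "open ((curves D ! i) -` (- C))"
    by (intro open_vimage open_Compl \<open>closed C\<close> diagram_continuous[OF D len])
  have "((curves D ! i) has_vector_derivative direction D (i, t)) (at t)"
    by (rule diagram_has_derivative[OF D len])
  then have "((curves E ! i) has_vector_derivative direction D (i, t)) (at t)"
  proof (rule has_vector_derivative_transform_within_open[OF _ op])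
    show "t \<in> (curves D ! i) -` (- C)" using assms(3) p by simp
    fix s assume "s \<in> (curves D ! i) -` (- C)"
    then have "(i, s) \<in> points D - {p \<in> points D. position D p \<in> C}"
      using len by (simp add: points_def)
    then have "(i, s) \<in> points D - (\<Union>A \<in> set As. arc_points A)"
      unfolding arcs .
    then have "position E (i, s) = position D (i, s)" using same by blast
    then show "(curves D ! i) s = (curves E ! i) s" by simp
  qed
  then show ?thesis unfolding p by (simp add: vector_derivative_at)
qed

lemma replacement_crossing:
  assumes r: "replacement C As D E" and x: "crossing D p q" "position D p \<notin> C"
  shows "crossing E p q" "crossing_sign E p q = crossing_sign D p q"
proof -
  have pq: "p \<in> points D" "q \<in> points D" "position D q = position D p" "p \<in> over D"
    "\<not> same_point p q"
    using x(1) by (auto simp: crossing_def double_pair_def)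
  have arcs: "{p \<in> points D. position D p \<in> C} = (\<Union>A \<in> set As. arc_points A)"
    and same: "\<forall>p \<in> points D - (\<Union>A \<in> set As. arc_points A).
        position E p = position D p \<and> (p \<in> over E \<longleftrightarrow> p \<in> over D)"
    and len: "length (curves E) = length (curves D)"
    using r unfolding replacement_def arcs_in_def by auto
  have "p \<in> points D - (\<Union>A \<in> set As. arc_points A)" "q \<in> points D - (\<Union>A \<in> set As. arc_points A)"
    unfolding arcs[symmetric] using pq x(2) by auto
  then have "position E p = position D p" "position E q = position D q" "p \<in> over E"
    using same pq by auto
  then show "crossing E p q"
    using pq len by (simp add: crossing_def double_pair_def points_def)
  show "crossing_sign E p q = crossing_sign D p q"
    using replacement_direction[OF r pq(1)] replacement_direction[OF r pq(2)] x(2) pq(3)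
    by (simp add: crossing_sign_def)
qed

text \<open>
  Both preimages of a crossing have the same position. So if one of them is not on an arc then
  neither is, and the crossing is left alone by the replacement.
\<close>

lemma replacement_passages:
  assumes r: "replacement C As D E" and k: "k \<le> 1"
    and u: "(k, u) \<notin> (\<Union>A \<in> set As. arc_points A)" "u \<in> passages k e D"
  shows "u \<in> passages k e E"
proof -
  obtain v where v: "meets k e D u v" using u(2) by (auto simp: passages_def)
  have dp: "double_pair D (k, u) (1 - k, v)" by (rule meets_double_pair[OF v k])
  have "position D (k, u) \<notin> C"
  proof
    assume "position D (k, u) \<in> C"
    with dp have "(k, u) \<in> {p \<in> points D. position D p \<in> C}" by (simp add: double_pair_def)
    then show False using u(1) r unfolding replacement_def arcs_in_def by blast
  qed
  moreover have "position D (1 - k, v) = position D (k, u)"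
    using dp by (simp add: double_pair_def)
  ultimately have "meets k e E u v"
    using v replacement_crossing[OF r] k unfolding meets_def
    by (cases "k = 0") (auto simp: le_Suc_eq)
  then show ?thesis by (auto simp: passages_def)
qed

text \<open>
  What the two local pictures have to satisfy so that exchanging them, in either direction, preserves
  the ballot property: on each arc of component \<open>k\<close> they have the same total of signs, and
  neither of them has an initial segment with a deficit.
\<close>

definition balanced_on :: "nat \<Rightarrow> arc list \<Rightarrow> diagram \<Rightarrow> diagram \<Rightarrow> bool" where
  "balanced_on k As D E \<longleftrightarrow> (\<forall>a b. (k, a, b) \<in> set As \<longrightarrow>
     ballot (passages k Pos D) (passages k Neg D) a b \<and>
     ballot (passages k Pos E) (passages k Neg E) a b \<and>
     card (passages k Pos D \<inter> {a..b}) + card (passages k Neg E \<inter> {a..b}) =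
       card (passages k Pos E \<inter> {a..b}) + card (passages k Neg D \<inter> {a..b}))"

lemma balanced_on_sym: "balanced_on k As D E \<Longrightarrow> balanced_on k As E D"
  by (auto simp: balanced_on_def)

lemma replacement_based_ballot:
  assumes r: "replacement C As D E" and k: "k \<le> 1" and z: "z \<notin> C"
    and bal: "balanced_on k As D E" and D: "based_ballot k z D"
  shows "based_ballot k z E"
proof -
  have dia: "is_diagram D" "is_diagram E" and len: "length (curves E) = length (curves D)"
    and arcs: "{p \<in> points D. position D p \<in> C} = (\<Union>A \<in> set As. arc_points A)"
    and disj: "sorted_wrt (\<lambda>A B. disjnt (arc_points A) (arc_points B)) As"
    and ab: "\<And>i a b. (i, a, b) \<in> set As \<Longrightarrow> a < b \<and> b < a + 1"
    and same: "\<forall>p \<in> points D - (\<Union>A \<in> set As. arc_points A). position E p = position D p"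
    using r unfolding replacement_def arcs_in_def by auto
  obtain \<tau> where \<tau>: "2 \<le> length (curves D)" "position D (k, \<tau>) = z"
      "ballot (passages k Pos D) (passages k Neg D) \<tau> (\<tau> + 1)"
    using D by (auto simp: based_ballot_def simp del: position.simps)
  have out: "(k, \<tau>) \<notin> (\<Union>A \<in> set As. arc_points A)"
    using \<tau>(2) z unfolding arcs[symmetric] by auto
  moreover have "(k, \<tau>) \<in> points D" using \<tau>(1) k by (simp add: points_def)
  ultimately have pos: "position E (k, \<tau>) = z" using same \<tau>(2) by (metis DiffI)
  have "ballot (passages k Pos E) (passages k Neg E) \<tau> (\<tau> + 1)"
  proof (rule ballot_replace_arcs[OF _ _ _ _ _ _ _ _ _ disj ab _ out \<tau>(3)])
    show "(u \<in> passages k Pos D \<longleftrightarrow> u \<in> passages k Pos E) \<and>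
        (u \<in> passages k Neg D \<longleftrightarrow> u \<in> passages k Neg E)"
      if "(k, u) \<notin> (\<Union>A \<in> set As. arc_points A)" for u
      using replacement_passages[OF r k that] replacement_passages[OF replacement_sym[OF r] k that]
      by blast
  qed (use bal finite_passages dia k passages_shift in \<open>auto simp: balanced_on_def\<close>)
  then show ?thesis using pos \<tau>(1) len by (auto simp: based_ballot_def)
qed

lemma passage_in_arcs:
  assumes "is_diagram D" "arcs_in C As D" "k \<le> 1" "(k, a, b) \<in> set As" "u \<in> {a..b}"
    and "u \<in> passages k e D"
  obtains c d v where "(1 - k, c, d) \<in> set As" "v \<in> {c..d}" "meets k e D u v"
proof -
  obtain v where v: "meets k e D u v" using assms(6) by (auto simp: passages_def)
  have dp: "double_pair D (k, u) (1 - k, v)" by (rule meets_double_pair[OF v assms(3)])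
  have arcs: "{p \<in> points D. position D p \<in> C} = (\<Union>A \<in> set As. arc_points A)"
    using assms(2) by (simp add: arcs_in_def)
  have "(k, u) \<in> arc_points (k, a, b)"
    using assms(5) by (auto intro!: exI[of _ u] exI[of _ "0::int"])
  then have "(k, u) \<in> {p \<in> points D. position D p \<in> C}" unfolding arcs using assms(4) by blast
  then have "(1 - k, v) \<in> {p \<in> points D. position D p \<in> C}"
    using dp by (simp add: double_pair_def)
  then obtain B where B: "B \<in> set As" "(1 - k, v) \<in> arc_points B" unfolding arcs by blast
  obtain j c d where Bd: "B = (j, c, d)" by (cases B)
  with B(2) obtain t m where t: "j = 1 - k" "v = t + of_int m" "t \<in> {c..d}" by auto
  have "meets k e D u t"
    using v t(2) meets_shift[OF assms(1), of k e u 0 t m] by simp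
  with that B(1) Bd t show ?thesis by blast
qed

section \<open>The moves\<close>

lemma ballot_if_no_negative:
  assumes "N \<inter> {a..b} = {}" shows "ballot P N a b"
proof -
  have "N \<inter> {a..<s} = {}" if "s \<le> b" for s
    using assms that by (fastforce simp: disjoint_iff)
  then show ?thesis by (simp add: ballot_def)
qed

lemma ballot_positive_before_negative:
  assumes "P \<inter> {a..b} = {p}" "N \<inter> {a..b} = {n}" "p < n"
  shows "ballot P N a b"
  unfolding ballot_def
proof
  fix s assume s: "s \<in> {a..b}"
  have P: "P \<inter> {a..<s} = {p} \<inter> {..<s}" and N: "N \<inter> {a..<s} = {n} \<inter> {..<s}"
    using s unfolding assms(1,2)[symmetric] by auto
  show "card (N \<inter> {a..<s}) \<le> card (P \<inter> {a..<s})"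
    unfolding P N using assms(3) by (cases "n < s") auto
qed

text \<open>
  The passages on the first arc that come from its crossings with the second arc.
\<close>

fun arc_meets :: "nat \<Rightarrow> sign \<Rightarrow> diagram \<Rightarrow> arc \<Rightarrow> arc \<Rightarrow> real set" where
  "arc_meets k e D (i, a, b) (j, c, d) =
     {u \<in> {a..b}. i = k \<and> j = 1 - k \<and> (\<exists>v \<in> {c..d}. meets k e D u v)}"

lemma passages_eq_arc_meets:
  assumes "is_diagram D" "arcs_in C As D" "k \<le> 1" "(k, a, b) \<in> set As"
  shows "passages k e D \<inter> {a..b} = (\<Union>X \<in> set As. arc_meets k e D (k, a, b) X)"
proof (intro equalityI subsetI)
  fix u assume "u \<in> passages k e D \<inter> {a..b}"
  then have u: "u \<in> {a..b}" "u \<in> passages k e D" by auto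
  obtain c d v where v: "(1 - k, c, d) \<in> set As" "v \<in> {c..d}" "meets k e D u v"
    by (rule passage_in_arcs[OF assms u])
  then have "u \<in> arc_meets k e D (k, a, b) (1 - k, c, d)" using u(1) by auto
  with v(1) show "u \<in> (\<Union>X \<in> set As. arc_meets k e D (k, a, b) X)" by blast
next
  fix u assume "u \<in> (\<Union>X \<in> set As. arc_meets k e D (k, a, b) X)"
  then obtain X where "u \<in> arc_meets k e D (k, a, b) X" by blast
  then show "u \<in> passages k e D \<inter> {a..b}" by (cases X) (auto simp: passages_def)
qed

lemma arc_meets_self: "arc_meets k e D A A = {}"
proof -
  have "k \<noteq> 1 - k" by arith
  then show ?thesis by (cases A) auto
qed

lemma meets_position:
  assumes "meets k e D u v" "k \<le> 1"
  shows "(curves D ! k) u = (curves D ! (1 - k)) v"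
  using meets_double_pair[OF assms] by (simp add: double_pair_def)

lemma arc_meets_disjoint:
  assumes "disjoint_arcs D A B" "k \<le> 1"
  shows "arc_meets k e D A B = {}" "arc_meets k e D B A = {}"
proof -
  obtain i a b j c d where AB: "A = (i, a, b)" "B = (j, c, d)" by (cases A, cases B)
  have dis: "(curves D ! i) s \<noteq> (curves D ! j) t" if "s \<in> {a..b}" "t \<in> {c..d}" for s t
    using assms(1) that unfolding AB disjoint_arcs.simps disjnt_iff by (metis imageI)
  show "arc_meets k e D A B = {}"
    using dis meets_position[OF _ assms(2)] unfolding AB by fastforce
  show "arc_meets k e D B A = {}"
    using dis meets_position[OF _ assms(2)] unfolding AB by fastforce
qed

text \<open>
  A kink creates only a crossing of a component with itself, and such crossings are not counted.
\<close>

lemma move1_balanced: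
  assumes "replacement C [A] D E" "k \<le> 1"
  shows "balanced_on k [A] D E"
proof -
  have "passages k e F \<inter> {a..b} = {}" if "A = (k, a, b)" "F \<in> {D, E}" for a b e F
    using passages_eq_arc_meets[of F C "[A]" k a b e] assms that
    by (auto simp: replacement_def arc_meets_self simp del: arc_meets.simps)
  then show ?thesis
    unfolding balanced_on_def by (metis ballot_if_no_negative insertCI list.set(1,2) singletonD)
qed

text \<open>
  If \<open>X\<close> lists all intersections of two arcs, and the first arc is over at each of them, then
  the passages can be read off from \<open>X\<close>. There are none unless the first arc belongs to component
  \<open>0\<close> and the second one to component \<open>1\<close>.
\<close>

lemma arc_meets_crossings:
  assumes D: "is_diagram D" and k: "k \<le> 1"
    and only: "\<And>s t. s \<in> {a..b} \<Longrightarrow> t \<in> {c..d} \<Longrightarrow> (curves D ! i) s = (curves D ! j) t \<Longrightarrow> (s, t) \<in> X"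
    and X: "\<And>s t. (s, t) \<in> X \<Longrightarrow> s \<in> {a..b} \<and> t \<in> {c..d} \<and> crossing D (i, s) (j, t)"
  shows "arc_meets k e D (i, a, b) (j, c, d) =
      (if k = 0 \<and> i = 0 \<and> j = 1 then fst ` {(s, t) \<in> X. crossing_sign D (i, s) (j, t) = e} else {})"
    and "arc_meets k e D (j, c, d) (i, a, b) =
      (if k = 1 \<and> i = 0 \<and> j = 1 then snd ` {(s, t) \<in> X. crossing_sign D (i, s) (j, t) = e} else {})"
proof -
  consider "k = 0" | "k = 1" using k by linarith
  note k_cases = this
  have no: "\<not> crossing D (j, t) (i, s)" if "(s, t) \<in> X" for s t
    using X[OF that] not_crossing_both[OF D] by blast
  have pos: "(curves D ! i) s = (curves D ! j) t"
    if "crossing D (i, s) (j, t) \<or> crossing D (j, t) (i, s)" for s t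
    using that by (auto simp: crossing_def double_pair_def)
  have iff: "crossing D (i, s) (j, t) \<longleftrightarrow> (s, t) \<in> X"
    and iff': "\<not> crossing D (j, t) (i, s)" if "s \<in> {a..b}" "t \<in> {c..d}" for s t
    using only[OF that] X pos no by blast+
  show "arc_meets k e D (i, a, b) (j, c, d) =
      (if k = 0 \<and> i = 0 \<and> j = 1 then fst ` {(s, t) \<in> X. crossing_sign D (i, s) (j, t) = e} else {})"
    using k_cases
  proof cases
    case 1
    show ?thesis
    proof (cases "i = 0 \<and> j = 1")
      case True
      have "u \<in> arc_meets k e D (i, a, b) (j, c, d) \<longleftrightarrow>
          (\<exists>v. (u, v) \<in> X \<and> crossing_sign D (i, u) (j, v) = e)" for u
      proof -
        have "u \<in> arc_meets k e D (i, a, b) (j, c, d) \<longleftrightarrow> (\<exists>v. u \<in> {a..b} \<and> v \<in> {c..d} \<and>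
            crossing D (i, u) (j, v) \<and> crossing_sign D (i, u) (j, v) = e)"
          using True 1 by (auto simp: meets_def)
        then show ?thesis using iff X by blast
      qed
      then show ?thesis using True 1 by (auto simp: image_iff)
    qed (use 1 in auto)
  next
    case 2
    then show ?thesis using iff' by (auto simp: meets_def)
  qed
  show "arc_meets k e D (j, c, d) (i, a, b) =
      (if k = 1 \<and> i = 0 \<and> j = 1 then snd ` {(s, t) \<in> X. crossing_sign D (i, s) (j, t) = e} else {})"
    using k_cases
  proof cases
    case 2
    show ?thesis
    proof (cases "i = 0 \<and> j = 1")
      case True
      have "u \<in> arc_meets k e D (j, c, d) (i, a, b) \<longleftrightarrow>
          (\<exists>v. (v, u) \<in> X \<and> crossing_sign D (i, v) (j, u) = e)" for u
      proof -
        have "u \<in> arc_meets k e D (j, c, d) (i, a, b) \<longleftrightarrow> (\<exists>v. u \<in> {c..d} \<and> v \<in> {a..b} \<and>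
            crossing D (i, v) (j, u) \<and> crossing_sign D (i, v) (j, u) = e)"
          using True 2 by (auto simp: meets_def)
        then show ?thesis using iff X by blast
      qed
      then show ?thesis using True 2 by (auto simp: image_iff)
    qed (use 2 in auto)
  next
    case 1
    then show ?thesis using iff' by (auto simp: meets_def)
  qed
qed

text \<open>
  The followed arc either gains no passage, or it gains one positive and one negative passage in this
  order. It is the over-strand of the bigon for \<open>k = 0\<close> and the under-strand for \<open>k = 1\<close>,
  so it is the order on this strand that matters.
\<close>

lemma move2_balanced:
  assumes r: "replacement C [A, B] D E" and dis: "disjoint_arcs D A B"
    and big: "bigon ord E A B" and k: "k \<le> 1" and pos_first: "if k = 0 then fst ord else snd ord"
  shows "balanced_on k [A, B] D E"
proof -
  have D: "is_diagram D" "arcs_in C [A, B] D" and E: "is_diagram E" "arcs_in C [A, B] E"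
    using r by (auto simp: replacement_def)
  have none: "passages k e D \<inter> {x..y} = {}" if "(k, x, y) \<in> {A, B}" for e x y
    using passages_eq_arc_meets[OF D k, of x y e] arc_meets_disjoint[OF dis k, of e] that
    by (auto simp: arc_meets_self simp del: arc_meets.simps)
  obtain i a b j c d where AB: "A = (i, a, b)" "B = (j, c, d)" by (cases A, cases B)
  obtain op on up un where
    par: "{op, on} \<subseteq> {a..b}" "{up, un} \<subseteq> {c..d}"
    and only: "\<And>s t. s \<in> {a..b} \<Longrightarrow> t \<in> {c..d} \<Longrightarrow>
        (curves E ! i) s = (curves E ! j) t \<longleftrightarrow> s = op \<and> t = up \<or> s = on \<and> t = un"
    and P: "crossing E (i, op) (j, up)" "crossing_sign E (i, op) (j, up) = Pos"
    and N: "crossing E (i, on) (j, un)" "crossing_sign E (i, on) (j, un) = Neg"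
    and ord: "ord = (op < on, up < un)"
    using big unfolding bigon_def AB by auto
  have meets: "arc_meets k e E (i, a, b) (j, c, d) =
      (if k = 0 \<and> i = 0 \<and> j = 1
       then fst ` {(s, t) \<in> {(op, up), (on, un)}. crossing_sign E (i, s) (j, t) = e} else {})"
    "arc_meets k e E (j, c, d) (i, a, b) =
      (if k = 1 \<and> i = 0 \<and> j = 1
       then snd ` {(s, t) \<in> {(op, up), (on, un)}. crossing_sign E (i, s) (j, t) = e} else {})" for e
    by (rule arc_meets_crossings[OF E(1) k]; use only par P(1) N(1) in auto)+
  have sel: "{(s, t) \<in> {(op, up), (on, un)}. crossing_sign E (i, s) (j, t) = Pos} = {(op, up)}"
    "{(s, t) \<in> {(op, up), (on, un)}. crossing_sign E (i, s) (j, t) = Neg} = {(on, un)}"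
    using P(2) N(2) by auto
  have E_arc: "(\<exists>p n. p < n \<and> passages k Pos E \<inter> {x..y} = {p} \<and> passages k Neg E \<inter> {x..y} = {n}) \<or>
      passages k Pos E \<inter> {x..y} = {} \<and> passages k Neg E \<inter> {x..y} = {}"
    if X: "(k, x, y) \<in> {A, B}" for x y
  proof -
    have arc: "passages k e E \<inter> {x..y} =
        arc_meets k e E (k, x, y) (i, a, b) \<union> arc_meets k e E (k, x, y) (j, c, d)" for e
      using passages_eq_arc_meets[OF E k, of x y e] X
      by (simp add: AB del: arc_meets.simps)
    consider "(k, x, y) = (i, a, b)" | "(k, x, y) = (j, c, d)" using X unfolding AB by blast
    then show ?thesis
    proof cases
      case 1
      then show ?thesis
        using pos_first unfolding arc AB 1 arc_meets_self meets sel ord by auto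
    next
      case 2
      then show ?thesis
        using pos_first unfolding arc AB 2 arc_meets_self meets sel ord by auto
    qed
  qed
  show ?thesis
    unfolding balanced_on_def
  proof (intro allI impI)
    fix x y assume "(k, x, y) \<in> set [A, B]"
    then have arc: "(k, x, y) \<in> {A, B}" by simp
    have "ballot (passages k Pos E) (passages k Neg E) x y \<and>
        card (passages k Pos E \<inter> {x..y}) = card (passages k Neg E \<inter> {x..y})"
      using E_arc[OF arc]
    proof
      assume "\<exists>p n. p < n \<and> passages k Pos E \<inter> {x..y} = {p} \<and> passages k Neg E \<inter> {x..y} = {n}"
      then show ?thesis by (auto intro: ballot_positive_before_negative)
    qed (auto intro: ballot_if_no_negative)
    then show "ballot (passages k Pos D) (passages k Neg D) x y \<and>
        ballot (passages k Pos E) (passages k Neg E) x y \<and>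
        card (passages k Pos D \<inter> {x..y}) + card (passages k Neg E \<inter> {x..y}) =
        card (passages k Pos E \<inter> {x..y}) + card (passages k Neg D \<inter> {x..y})"
      using none[OF arc] ballot_if_no_negative by auto
  qed
qed

lemma cross_once_posD:
  assumes "cross_once_pos D (i, a, b) (j, c, d) u v"
  shows "u \<in> {a..b}" "v \<in> {c..d}" "crossing D (i, u) (j, v)" "double_pair D (i, u) (j, v)"
    "\<And>s t. s \<in> {a..b} \<Longrightarrow> t \<in> {c..d} \<Longrightarrow> (curves D ! i) s = (curves D ! j) t \<Longrightarrow> s = u \<and> t = v"
  using assms by (auto simp: crossing_def)

lemma arc_meets_cross_once_pos:
  assumes "is_diagram D" "k \<le> 1" "cross_once_pos D A B u v"
  shows "arc_meets k Pos D A B = (if k = 0 \<and> fst A = 0 \<and> fst B = 1 then {u} else {})"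
    and "arc_meets k Pos D B A = (if k = 1 \<and> fst A = 0 \<and> fst B = 1 then {v} else {})"
    and "arc_meets k Neg D A B = {}" and "arc_meets k Neg D B A = {}"
proof -
  obtain i a b j c d where AB: "A = (i, a, b)" "B = (j, c, d)" by (cases A, cases B)
  have sign: "crossing_sign D (i, u) (j, v) = Pos" using assms(3) by (simp add: AB)
  note x = cross_once_posD[OF assms(3)[unfolded AB]]
  have only: "(s, t) \<in> {(u, v)}"
    if "s \<in> {a..b}" "t \<in> {c..d}" "(curves D ! i) s = (curves D ! j) t" for s t
    using x(5)[OF that] by simp
  have X: "s \<in> {a..b} \<and> t \<in> {c..d} \<and> crossing D (i, s) (j, t)" if "(s, t) \<in> {(u, v)}" for s t
    using that x(1,2,3) by simp
  have meets: "arc_meets k e D (i, a, b) (j, c, d) =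
      (if k = 0 \<and> i = 0 \<and> j = 1
       then fst ` {(s, t) \<in> {(u, v)}. crossing_sign D (i, s) (j, t) = e} else {})"
    "arc_meets k e D (j, c, d) (i, a, b) =
      (if k = 1 \<and> i = 0 \<and> j = 1
       then snd ` {(s, t) \<in> {(u, v)}. crossing_sign D (i, s) (j, t) = e} else {})" for e
    by (rule arc_meets_crossings[OF assms(1,2)], (rule only; assumption), (rule X; assumption))+
  have sel: "{(s, t) \<in> {(u, v)}. crossing_sign D (i, s) (j, t) = Pos} = {(u, v)}"
    "{(s, t) \<in> {(u, v)}. crossing_sign D (i, s) (j, t) = Neg} = {}"
    using sign by auto
  show "arc_meets k Pos D A B = (if k = 0 \<and> fst A = 0 \<and> fst B = 1 then {u} else {})"
    "arc_meets k Pos D B A = (if k = 1 \<and> fst A = 0 \<and> fst B = 1 then {v} else {})"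
    "arc_meets k Neg D A B = {}" "arc_meets k Neg D B A = {}"
    unfolding AB meets sel by simp_all
qed

text \<open>
  Every two of the strands cross once and positively, so the passages on a strand are counted by the
  strands that belong to the other component and lie on the relevant side of it. The two crossings on
  one strand are different points since a diagram has no triple points.
\<close>

lemma triangle_passages:
  assumes D: "is_diagram D" "arcs_in C [T, M, B] D" and tri: "triangle_pos ord D T M B" and k: "k \<le> 1"
    and X: "(k, x, y) \<in> {T, M, B}"
  shows "passages k Neg D \<inter> {x..y} = {}"
    and "card (passages k Pos D \<inter> {x..y}) =
      (if k = 0 then (if (k, x, y) = T then of_bool (fst M = 1) + of_bool (fst B = 1)
         else if (k, x, y) = M then of_bool (fst B = 1) else 0)
       else (if (k, x, y) = T then 0 else if (k, x, y) = M then of_bool (fst T = 0)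
         else of_bool (fst T = 0) + of_bool (fst M = 0)))"
proof -
  obtain tm mt tb bt mb bm where
    TM: "cross_once_pos D T M tm mt" and TB: "cross_once_pos D T B tb bt" and MB: "cross_once_pos D M B mb bm"
    using tri unfolding triangle_pos_def by blast
  have ne: "tm \<noteq> tb \<and> bt \<noteq> bm"
  proof -
    obtain i a b j c d l g h where arcs: "T = (i, a, b)" "M = (j, c, d)" "B = (l, g, h)"
      by (cases T, cases M, cases B)
    note tm = cross_once_posD[OF TM[unfolded arcs]] and tb = cross_once_posD[OF TB[unfolded arcs]]
      and mb = cross_once_posD[OF MB[unfolded arcs]]
    have pos: "(curves D ! i) tm = (curves D ! j) mt" "(curves D ! i) tb = (curves D ! l) bt"
      "(curves D ! j) mb = (curves D ! l) bm"
      using tm(4) tb(4) mb(4) by (simp_all add: double_pair_def)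
    have "tm \<noteq> tb"
    proof
      assume eq: "tm = tb"
      then have "mt = mb \<and> bt = bm" using pos tm(2) tb(2) by (intro mb(5)) auto
      then show False using no_triple_point[OF D(1) tm(4), of "(l, bm)"] mb(4) tb(4) eq by simp
    qed
    moreover have "bt \<noteq> bm"
    proof
      assume eq: "bt = bm"
      then have "tb = tm \<and> mb = mt" using pos tb(1) mb(1) by (intro tm(5)) auto
      then show False using no_triple_point[OF D(1) tm(4), of "(l, bm)"] mb(4) tb(4) eq by simp
    qed
    ultimately show ?thesis by blast
  qed
  have arc: "passages k e D \<inter> {x..y} = arc_meets k e D (k, x, y) T \<union>
      arc_meets k e D (k, x, y) M \<union> arc_meets k e D (k, x, y) B" for e
    using passages_eq_arc_meets[OF D k, of x y e] X by (simp add: Un_assoc del: arc_meets.simps)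
  note meets = arc_meets_cross_once_pos[OF D(1) k TM] arc_meets_cross_once_pos[OF D(1) k TB]
    arc_meets_cross_once_pos[OF D(1) k MB] arc_meets_self
  consider "(k, x, y) = T" | "(k, x, y) = M" "M \<noteq> T" | "(k, x, y) = B" "B \<noteq> T" "B \<noteq> M"
    using X by blast
  note X_cases = this
  show "passages k Neg D \<inter> {x..y} = {}"
    unfolding arc by (rule X_cases; simp add: meets del: arc_meets.simps)
  have comp: "k = fst (k, x, y)" by simp
  show "card (passages k Pos D \<inter> {x..y}) =
      (if k = 0 then (if (k, x, y) = T then of_bool (fst M = 1) + of_bool (fst B = 1)
         else if (k, x, y) = M then of_bool (fst B = 1) else 0)
       else (if (k, x, y) = T then 0 else if (k, x, y) = M then of_bool (fst T = 0)
         else of_bool (fst T = 0) + of_bool (fst M = 0)))"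
    using X_cases
  proof cases
    case 1
    then have "fst T = k" by auto
    then show ?thesis unfolding arc 1 using ne k by (simp add: meets del: arc_meets.simps)
  next
    case 2
    then have "fst M = k" by auto
    then show ?thesis unfolding arc 2(1) using ne k 2(2) by (simp add: meets del: arc_meets.simps)
  next
    case 3
    then have "fst B = k" by auto
    then show ?thesis unfolding arc 3(1) using ne k 3(2,3) by (simp add: meets del: arc_meets.simps)
  qed
qed

text \<open>
  There are no negative passages on the arcs, and the number of positive ones depends only on the
  components to which the three strands belong, which the move does not change.
\<close>

lemma move3_balanced:
  assumes r: "replacement C [T, M, B] D E" and k: "k \<le> 1"
    and tri: "triangle_pos ord D T M B" "triangle_pos ord' E T M B"
  shows "balanced_on k [T, M, B] D E"
  unfolding balanced_on_def
proof (intro allI impI)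
  fix x y assume "(k, x, y) \<in> set [T, M, B]"
  then have X: "(k, x, y) \<in> {T, M, B}" by simp
  have D: "is_diagram D" "arcs_in C [T, M, B] D" and E: "is_diagram E" "arcs_in C [T, M, B] E"
    using r by (auto simp: replacement_def)
  note tD = triangle_passages[OF D tri(1) k X] and tE = triangle_passages[OF E tri(2) k X]
  show "ballot (passages k Pos D) (passages k Neg D) x y \<and>
        ballot (passages k Pos E) (passages k Neg E) x y \<and>
        card (passages k Pos D \<inter> {x..y}) + card (passages k Neg E \<inter> {x..y}) =
        card (passages k Pos E \<inter> {x..y}) + card (passages k Neg D \<inter> {x..y})"
    using tD(1) tE(1) ballot_if_no_negative by (auto simp: tD(2) tE(2))
qed

section \<open>Reparametrizations and isotopies\<close>

lemma lift_of_circle_map: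
  fixes \<phi> :: "real \<Rightarrow> real"
  assumes "smooth_on UNIV \<phi>" "\<And>t. deriv \<phi> t > 0" "\<And>t. \<phi> (t + 1) = \<phi> t + 1"
  shows "(\<phi> has_vector_derivative deriv \<phi> t) (at t)" "strict_mono \<phi>" "surj \<phi>"
proof -
  have der: "(\<phi> has_real_derivative deriv \<phi> t) (at t)" for t
  proof -
    have "(\<phi> has_real_derivative vector_derivative \<phi> (at t)) (at t)"
      using smooth_on_has_vector_derivative[OF assms(1)]
      by (simp add: has_real_derivative_iff_has_vector_derivative)
    then show ?thesis using DERIV_imp_deriv by fastforce
  qed
  then show "(\<phi> has_vector_derivative deriv \<phi> t) (at t)"
    by (simp add: has_real_derivative_iff_has_vector_derivative)
  show "strict_mono \<phi>"
    unfolding strict_mono_def using der assms(2) by (blast intro: DERIV_pos_imp_increasing)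
  have nat_shift: "\<phi> (t + of_nat n) = \<phi> t + of_nat n" for t n
  proof (induction n)
    case (Suc n)
    then show ?case using assms(3)[of "t + of_nat n"] by (simp add: algebra_simps)
  qed simp
  show "surj \<phi>"
    unfolding surj_def
  proof
    fix y
    obtain n :: nat where n: "\<bar>y - \<phi> 0\<bar> \<le> of_nat n" using real_arch_simple by blast
    have "\<phi> (- of_nat n) \<le> y" "y \<le> \<phi> (of_nat n)"
      using n nat_shift[of "- of_nat n" n] nat_shift[of 0 n] by auto
    moreover have "continuous_on {- of_nat n..of_nat n} \<phi>"
      using smooth_on_imp_continuous_on[OF assms(1)] continuous_on_subset by blast
    ultimately obtain x where "\<phi> x = y"
      using IVT'[of \<phi> "- of_nat n" y "of_nat n"] by auto
    then show "\<exists>x. y = \<phi> x" by blast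
  qed
qed

text \<open>
  The reparametrization of the followed component is an increasing bijection that carries the passages
  of \<open>E\<close> to those of \<open>D\<close>, and positive factors in the tangent vectors do not affect signs.
\<close>

lemma same_diagram_based_ballot:
  assumes same: "same_diagram D E" and k: "k \<le> 1" and D: "based_ballot k z D"
  shows "based_ballot k z E"
proof -
  obtain \<tau> where \<tau>: "2 \<le> length (curves D)" "position D (k, \<tau>) = z"
      "ballot (passages k Pos D) (passages k Neg D) \<tau> (\<tau> + 1)"
    using D by (auto simp: based_ballot_def simp del: position.simps)
  have len: "length (curves E) = length (curves D)" and dia: "is_diagram D"
    using same by (auto simp: same_diagram_def)
  have "\<forall>i. \<exists>\<phi>. i < length (curves D) \<longrightarrow>
      smooth_on UNIV \<phi> \<and> (\<forall>t. deriv \<phi> t > 0) \<and> (\<forall>t. \<phi> (t + 1) = \<phi> t + 1) \<and>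
      (\<forall>t. (curves E ! i) t = (curves D ! i) (\<phi> t) \<and> ((i, t) \<in> over E \<longleftrightarrow> (i, \<phi> t) \<in> over D))"
    using same unfolding same_diagram_def by blast
  then obtain \<phi> where \<phi>: "\<And>i. i < length (curves D) \<Longrightarrow>
      smooth_on UNIV (\<phi> i) \<and> (\<forall>t. deriv (\<phi> i) t > 0) \<and> (\<forall>t. \<phi> i (t + 1) = \<phi> i t + 1) \<and>
      (\<forall>t. (curves E ! i) t = (curves D ! i) (\<phi> i t) \<and> ((i, t) \<in> over E \<longleftrightarrow> (i, \<phi> i t) \<in> over D))"
    by metis
  have pos: "position E (i, t) = position D (i, \<phi> i t)"
    and over: "(i, t) \<in> over E \<longleftrightarrow> (i, \<phi> i t) \<in> over D" if "i < length (curves D)" for i t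
    using \<phi>[OF that] by auto
  have mono: "strict_mono (\<phi> i)" and surj: "surj (\<phi> i)"
    and der: "(\<phi> i has_vector_derivative deriv (\<phi> i) t) (at t)" and dpos: "deriv (\<phi> i) t > 0"
    if "i < length (curves D)" for i t
    using lift_of_circle_map[of "\<phi> i"] \<phi>[OF that] by auto
  have dir: "direction E (i, t) = deriv (\<phi> i) t *\<^sub>R direction D (i, \<phi> i t)"
    if "i < length (curves D)" for i t
  proof -
    have "((curves D ! i \<circ> \<phi> i) has_vector_derivative deriv (\<phi> i) t *\<^sub>R direction D (i, \<phi> i t)) (at t)"
      by (intro vector_diff_chain_at der diagram_has_derivative dia that)
    moreover have "curves D ! i \<circ> \<phi> i = curves E ! i" using \<phi>[OF that] by auto
    ultimately show ?thesis by (simp add: vector_derivative_at)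
  qed
  have cross: "crossing E (0, s) (1, t) \<longleftrightarrow> crossing D (0, \<phi> 0 s) (1, \<phi> 1 t)"
    and sign: "crossing_sign E (0, s) (1, t) = crossing_sign D (0, \<phi> 0 s) (1, \<phi> 1 t)" for s t
  proof -
    have l: "0 < length (curves D)" "1 < length (curves D)" using \<tau>(1) by auto
    show "crossing E (0, s) (1, t) \<longleftrightarrow> crossing D (0, \<phi> 0 s) (1, \<phi> 1 t)"
      unfolding crossing_def double_pair_def pos[OF l(1)] pos[OF l(2)] over[OF l(1)]
      using len by (simp add: points_def)
    have "det2 (direction E (0, s)) (direction E (1, t)) = deriv (\<phi> 0) s * deriv (\<phi> 1) t *
        det2 (direction D (0, \<phi> 0 s)) (direction D (1, \<phi> 1 t))"
      unfolding dir[OF l(1)] dir[OF l(2)] by (simp add: det2_def algebra_simps)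
    moreover have "deriv (\<phi> 0) s * deriv (\<phi> 1) t > 0" using dpos l by simp
    ultimately show "crossing_sign E (0, s) (1, t) = crossing_sign D (0, \<phi> 0 s) (1, \<phi> 1 t)"
      unfolding crossing_sign_def by (metis zero_less_mult_pos mult_pos_pos)
  qed
  have kl: "k < length (curves D)" "1 - k < length (curves D)" using \<tau>(1) k by auto
  have meets: "meets k e E u v \<longleftrightarrow> meets k e D (\<phi> k u) (\<phi> (1 - k) v)" for e u v
    using k unfolding meets_def cross sign by (cases "k = 0") (auto simp: le_Suc_eq)
  have pass: "u \<in> passages k e E \<longleftrightarrow> \<phi> k u \<in> passages k e D" for e u
  proof -
    have "(\<exists>v. meets k e D (\<phi> k u) (\<phi> (1 - k) v)) \<longleftrightarrow> (\<exists>w. meets k e D (\<phi> k u) w)"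
      using surjD[OF surj[OF kl(2)]] by metis
    then show ?thesis by (simp add: passages_def meets)
  qed
  obtain \<tau>' where \<tau>': "\<phi> k \<tau>' = \<tau>" using surj[OF kl(1)] by (metis surjD)
  have less: "\<phi> k x < \<phi> k y \<longleftrightarrow> x < y" and le: "\<phi> k x \<le> \<phi> k y \<longleftrightarrow> x \<le> y" for x y
    using mono[OF kl(1)] by (simp_all add: strict_mono_less strict_mono_less_eq)
  have card_eq: "card (passages k e E \<inter> {\<tau>'..<s}) = card (passages k e D \<inter> {\<tau>..<\<phi> k s})" for e s
  proof (rule bij_betw_same_card[of "\<phi> k"])
    have "y \<in> \<phi> k ` (passages k e E \<inter> {\<tau>'..<s})" if y: "y \<in> passages k e D \<inter> {\<tau>..<\<phi> k s}" for y
    proof -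
      obtain x where "y = \<phi> k x" using surj[OF kl(1)] by (metis surjD)
      then show ?thesis using y pass less le \<tau>' by auto
    qed
    moreover have "\<phi> k ` (passages k e E \<inter> {\<tau>'..<s}) \<subseteq> passages k e D \<inter> {\<tau>..<\<phi> k s}"
      using pass less le \<tau>' by auto
    moreover have "inj_on (\<phi> k) (passages k e E \<inter> {\<tau>'..<s})"
      using mono[OF kl(1)] strict_mono_imp_inj_on inj_on_subset by blast
    ultimately show "bij_betw (\<phi> k) (passages k e E \<inter> {\<tau>'..<s}) (passages k e D \<inter> {\<tau>..<\<phi> k s})"
      unfolding bij_betw_def by blast
  qed
  have "ballot (passages k Pos E) (passages k Neg E) \<tau>' (\<tau>' + 1)"
    unfolding ballot_def card_eq
  proof
    fix s assume "s \<in> {\<tau>'..\<tau>' + 1}"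
    then have "\<phi> k s \<in> {\<tau>..\<tau> + 1}"
      using le[of \<tau>' s] le[of s "\<tau>' + 1"] \<tau>' \<phi>[OF kl(1)] by auto
    then show "card (passages k Neg D \<inter> {\<tau>..<\<phi> k s}) \<le> card (passages k Pos D \<inter> {\<tau>..<\<phi> k s})"
      using \<tau>(3) by (simp add: ballot_def)
  qed
  moreover have "position E (k, \<tau>') = z" using pos[OF kl(1)] \<tau>' \<tau>(2) by simp
  ultimately show ?thesis using \<tau>(1) len unfolding based_ballot_def by metis
qed

lemma diffeo_det_nonzero:
  assumes "diffeo f" "(f has_derivative A) (at z)"
  shows "det2 (A 1) (A \<i>) \<noteq> 0"
proof -
  obtain B where B: "(inv f has_derivative B) (at (f z))"
    using assms(1) smooth_on_derivative[of UNIV "inv f"] by (auto simp: diffeo_def)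
  have "((\<lambda>x. inv f (f x)) has_derivative (\<lambda>h. B (A h))) (at z)"
    by (rule has_derivative_compose[OF assms(2) B])
  moreover have "(\<lambda>x. inv f (f x)) = (\<lambda>x. x)"
    using assms(1) by (simp add: diffeo_def bij_def inv_f_f)
  ultimately have "(\<lambda>h. B (A h)) = (\<lambda>h. h)"
    using has_derivative_unique[OF _ has_derivative_ident] by metis
  then have "det2 (B 1) (B \<i>) * det2 (A 1) (A \<i>) = det2 1 \<i>"
    using det2_linear[of B "A 1" "A \<i>"] B has_derivative_linear by (metis (no_types, lifting))
  then show ?thesis by (auto simp: det2_def)
qed

text \<open>
  The Jacobian determinant of \<open>H s\<close> at \<open>z\<close> depends continuously on \<open>s\<close>, does not vanish,
  and is \<open>1\<close> for \<open>s = 0\<close>.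
\<close>

lemma isotopy_preserves_orientation:
  fixes H :: "real \<Rightarrow> complex \<Rightarrow> complex"
  assumes smooth: "smooth_on ({0..1} \<times> UNIV) (\<lambda>(s, z). H s z)"
    and diffeo: "\<And>s. s \<in> {0..1} \<Longrightarrow> diffeo (H s)" and start: "\<And>z. H 0 z = z"
  obtains L where "(H 1 has_derivative L) (at z)" "det2 (L 1) (L \<i>) > 0"
proof -
  obtain F' where
    F': "\<And>x. x \<in> {0..1} \<times> UNIV \<Longrightarrow> ((\<lambda>(s, z). H s z) has_derivative F' x) (at x within {0..1} \<times> UNIV)"
    and sm: "\<And>h. smooth_on ({0..1} \<times> UNIV) (\<lambda>x. F' x h)"
    using smooth_on_derivative[OF smooth] by blast
  define L where "L = (\<lambda>s h. F' (s, z) (0, h))"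
  have L: "(H s has_derivative L s) (at z)" if s: "s \<in> {0..1}" for s
  proof -
    have "((\<lambda>z. (s, z)) has_derivative (\<lambda>h. (0, h))) (at z)"
      by (intro has_derivative_Pair has_derivative_const has_derivative_ident)
    moreover have "((\<lambda>(s, z). H s z) has_derivative F' (s, z)) (at (s, z) within range (Pair s))"
      using F'[of "(s, z)"] s by (auto intro: has_derivative_subset)
    ultimately show ?thesis
      using has_derivative_in_compose[of "\<lambda>z. (s, z)" "\<lambda>h. (0, h)" z UNIV "\<lambda>(s, z). H s z" "F' (s, z)"]
      by (simp add: L_def)
  qed
  have cont: "continuous_on {0..1} (\<lambda>s. L s h)" for h
    unfolding L_def
    by (rule continuous_on_compose2[OF smooth_on_imp_continuous_on[OF sm]])
      (auto intro: continuous_intros)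
  define d where "d = (\<lambda>s. det2 (L s 1) (L s \<i>))"
  have "continuous_on {0..1} d"
    unfolding d_def det2_def by (intro continuous_intros cont)
  moreover have "d s \<noteq> 0" if "s \<in> {0..1}" for s
    unfolding d_def by (rule diffeo_det_nonzero[OF diffeo[OF that] L[OF that]])
  moreover have "d 0 > 0"
  proof -
    have "H 0 = (\<lambda>z. z)" using start by auto
    moreover have "(H 0 has_derivative L 0) (at z)" by (rule L) simp
    ultimately have "L 0 = (\<lambda>h. h)"
      using has_derivative_unique[OF _ has_derivative_ident] by auto
    then show ?thesis by (simp add: d_def det2_def)
  qed
  ultimately have "d 1 > 0"
    using IVT2'[of d 1 0 0] by (force simp: not_less)
  then show thesis using that L[of 1] by (simp add: d_def)
qed

text \<open>
  Being injective and orientation-preserving, the final diffeomorphism carries crossings to crossings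
  of the same sign, at the same parameters, and it fixes the base point.
\<close>

lemma isotopic_based_ballot:
  assumes iso: "isotopic_in C D E" and k: "k \<le> 1" and z: "z \<notin> C" and D: "based_ballot k z D"
  shows "based_ballot k z E"
proof -
  have dia: "is_diagram D" using iso by (simp add: isotopic_in_def)
  obtain H :: "real \<Rightarrow> complex \<Rightarrow> complex" where smooth: "smooth_on ({0..1} \<times> UNIV) (\<lambda>(s, z). H s z)"
    and H: "\<forall>s \<in> {0..1}. diffeo (H s) \<and> (\<forall>z. z \<notin> C \<longrightarrow> H s z = z)"
    and start: "\<forall>z. H 0 z = z"
    and cE: "curves E = map (\<lambda>\<gamma>. H 1 \<circ> \<gamma>) (curves D)" and oE: "over E = over D"
    using iso unfolding isotopic_in_def by blast
  have diffeo: "diffeo (H s)" if "s \<in> {0..1}" for s using H that by blast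
  have fixed: "H 1 w = w" if "w \<notin> C" for w using H that by simp
  have pos: "position E (i, t) = H 1 (position D (i, t))" if "i < length (curves D)" for i t
    using that by (simp add: cE)
  have inj: "H 1 x = H 1 y \<longleftrightarrow> x = y" for x y
    using diffeo[of 1] by (auto simp: diffeo_def bij_def inj_def)
  have dp: "double_pair E p q \<longleftrightarrow> double_pair D p q" for p q
    by (cases p; cases q) (auto simp: double_pair_def points_def cE inj)
  have cross: "crossing E p q \<longleftrightarrow> crossing D p q" for p q
    by (simp add: crossing_def dp oE)
  have sign: "crossing_sign E p q = crossing_sign D p q" if "crossing D p q" for p q
  proof -
    obtain i s j t where pq: "p = (i, s)" "q = (j, t)" by (cases p, cases q)
    have len: "i < length (curves D)" "j < length (curves D)"
      and eq: "(curves D ! i) s = (curves D ! j) t"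
      using that by (auto simp: crossing_def double_pair_def points_def pq)
    obtain L where L: "(H 1 has_derivative L) (at ((curves D ! i) s))" "det2 (L 1) (L \<i>) > 0"
      using isotopy_preserves_orientation[OF smooth diffeo] start by metis
    have lin: "linear L" using L(1) has_derivative_linear by blast
    have dir: "direction E (l, r) = L (direction D (l, r))"
      if l: "l < length (curves D)" "(curves D ! l) r = (curves D ! i) s" for l r
    proof -
      have "((H 1 \<circ> curves D ! l) has_derivative L \<circ> (\<lambda>h. h *\<^sub>R direction D (l, r))) (at r)"
        using diagram_has_derivative[OF dia l(1), of r] L(1) l(2)
        by (intro diff_chain_at) (simp_all add: has_vector_derivative_def)
      then have "((curves E ! l) has_vector_derivative L (direction D (l, r))) (at r)"
        using l(1) by (simp add: cE has_vector_derivative_def o_def linear_scale[OF lin])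
      then show ?thesis by (simp add: vector_derivative_at)
    qed
    have "det2 (direction E p) (direction E q) =
        det2 (L 1) (L \<i>) * det2 (direction D p) (direction D q)"
      unfolding pq dir[OF len(1) refl] dir[OF len(2) eq[symmetric]] by (rule det2_linear[OF lin])
    then show ?thesis
      using L(2) by (simp add: crossing_sign_def zero_less_mult_iff)
  qed
  have "passages k e E = passages k e D" for e
    using sign unfolding passages_def meets_def cross by metis
  then show ?thesis
    using D pos[of k] fixed[OF z] k unfolding based_ballot_def
    by (auto simp: cE)
qed

section \<open>Two circles and a finger move\<close>

text \<open>
  The shape of the finger. It starts at \<open>u = 3/4\<close>, where the circle of radius \<open>1\<close> around
  \<open>-3/2\<close> enters the unit disk. Its height \<open>5/4\<close> at \<open>u = 1\<close> moves the tip from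
  \<open>-1/2\<close> to \<open>3/4\<close>, past the leftmost point \<open>1/2\<close> of the circle around \<open>3/2\<close>. As
  the height is less than \<open>3/2\<close>, the finger stays in the unit disk.
\<close>

definition bump :: "real \<Rightarrow> real" where
  "bump u = 5/4 * exp 4 * flat 1 (u - 3/4)"

definition bump' :: "real \<Rightarrow> real" where
  "bump' u = 5/4 * exp 4 * flat (monom 1 2) (u - 3/4)"

lemma bump_has_derivative: "(bump has_real_derivative bump' u) (at u)"
proof -
  have "(flat 1 has_real_derivative flat (monom 1 2) (u - 3/4)) (at (u - 3/4))"
    using flat_has_derivative[of 1 "u - 3/4"]
    by (simp add: has_real_derivative_iff_has_vector_derivative)
  then show ?thesis
    unfolding bump_def[abs_def] bump'_def
    by (auto intro!: derivative_eq_intros DERIV_chain2[of "flat 1"])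
qed

lemma bump'_nonneg: "bump' u \<ge> 0"
  by (simp add: bump'_def flat_def poly_monom)

lemma bump_eq_0: "u \<le> 3/4 \<Longrightarrow> bump u = 0"
  by (simp add: bump_def flat_def)

lemma bump_nonneg: "bump u \<ge> 0"
  by (simp add: bump_def flat_def)

lemma bump_1: "bump 1 = 5/4"
  by (simp add: bump_def flat_def exp_minus)

lemma bump_mono: "u \<le> v \<Longrightarrow> bump u \<le> bump v"
  by (rule DERIV_nonneg_imp_nondecreasing) (use bump_has_derivative bump'_nonneg in blast)+

lemma bump_le: "u \<le> 1 \<Longrightarrow> bump u \<le> 5/4"
  using bump_mono[of u 1] bump_1 by simp

lemma Ck_bump: "Ck n bump"
proof -
  have "Ck n (\<lambda>u::real. u - 3/4)"
    using Ck_add[OF Ck_linear[of n 1] Ck_const[of n "-3/4"]] by simp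
  then have "Ck n (\<lambda>u. flat 1 (u - 3/4))" by (rule Ck_compose[OF Ck_flat])
  then have "Ck n (\<lambda>u. 5/4 * exp 4 * flat 1 (u - 3/4))" by (rule Ck_mult[OF Ck_const])
  then show ?thesis unfolding bump_def[abs_def] .
qed

text \<open>
  A circle of radius \<open>1\<close> with its horizontal coordinate modified as a function of the cosine. All
  curves of the example have this form. They share the vertical coordinate, so at an intersection of
  two of them the cosines agree up to sign.
\<close>

definition graph_curve :: "(real \<Rightarrow> real) \<Rightarrow> real \<Rightarrow> complex" where
  "graph_curve X t = Complex (X (cos (2 * pi * t))) (sin (2 * pi * t))"

lemma graph_curve_smooth:
  assumes "\<And>n. Ck n X" shows "smooth_on UNIV (graph_curve X)"
proof (rule smooth_on_UNIV_if_Ck)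
  fix n
  have trig: "Ck n (\<lambda>t::real. cos (2 * pi * t))" "Ck n (\<lambda>t::real. sin (2 * pi * t))"
    using Ck_sin_cos[of n] Ck_linear[of n "2 * pi"] by (auto intro: Ck_compose)
  have "Ck n (\<lambda>t. complex_of_real (X (cos (2 * pi * t))))"
    by (intro Ck_bounded_linear[OF bounded_linear_of_real] Ck_compose[OF assms] trig)
  moreover have "Ck n (\<lambda>t::real. \<i> * complex_of_real (sin (2 * pi * t)))"
    by (intro Ck_bounded_linear[OF bounded_linear_mult_right] Ck_bounded_linear[OF bounded_linear_of_real] trig)
  ultimately have "Ck n (\<lambda>t. complex_of_real (X (cos (2 * pi * t))) + \<i> * complex_of_real (sin (2 * pi * t)))"
    by (rule Ck_add)
  then show "Ck n (graph_curve X)"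
    unfolding graph_curve_def[abs_def] Complex_eq .
qed

lemma graph_curve_derivative:
  assumes "\<And>u. (X has_real_derivative X' u) (at u)"
  shows "vector_derivative (graph_curve X) (at t) =
    Complex (- 2 * pi * sin (2 * pi * t) * X' (cos (2 * pi * t))) (2 * pi * cos (2 * pi * t))"
proof -
  have "((\<lambda>t. cos (2 * pi * t)) has_real_derivative - 2 * pi * sin (2 * pi * t)) (at t)"
    by (auto intro!: derivative_eq_intros)
  from DERIV_chain2[OF assms this]
  have "((\<lambda>t. X (cos (2 * pi * t))) has_real_derivative - 2 * pi * sin (2 * pi * t) * X' (cos (2 * pi * t))) (at t)"
    by (simp add: mult_ac)
  moreover have "((\<lambda>t. sin (2 * pi * t)) has_real_derivative 2 * pi * cos (2 * pi * t)) (at t)"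
    by (auto intro!: derivative_eq_intros)
  ultimately have "(graph_curve X has_vector_derivative
      Complex (- 2 * pi * sin (2 * pi * t) * X' (cos (2 * pi * t))) (2 * pi * cos (2 * pi * t))) (at t)"
    unfolding has_vector_derivative_complex_iff graph_curve_def
    by (simp add: has_real_derivative_iff_has_vector_derivative)
  then show ?thesis by (rule vector_derivative_at)
qed

lemma sin_cos_turns_eq_iff:
  "sin (2 * pi * s) = sin (2 * pi * t) \<and> cos (2 * pi * s) = cos (2 * pi * t) \<longleftrightarrow> s - t \<in> \<int>"
proof -
  have "2 * pi * s = 2 * pi * t + 2 * pi * of_int n \<longleftrightarrow> s - t = of_int n" for n :: int
  proof -
    have "2 * pi * s = 2 * pi * t + 2 * pi * of_int n \<longleftrightarrow> 2 * pi * s = 2 * pi * (t + of_int n)"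
      by (simp add: algebra_simps)
    also have "\<dots> \<longleftrightarrow> s = t + of_int n" by simp
    finally show ?thesis by auto
  qed
  then show ?thesis unfolding sin_cos_eq_iff by (auto simp: Ints_def)
qed

lemma graph_curve_eq_iff:
  assumes "inj_on X {-1..1}"
  shows "graph_curve X s = graph_curve X t \<longleftrightarrow> s - t \<in> \<int>"
  using assms unfolding sin_cos_turns_eq_iff[symmetric] graph_curve_def
  by (auto dest: inj_onD)

lemma cos_turn_le_iff:
  assumes "\<bar>t\<bar> \<le> 1/2" "0 \<le> b" "b \<le> 1/2"
  shows "cos (2 * pi * t) \<le> cos (2 * pi * b) \<longleftrightarrow> b \<le> \<bar>t\<bar>"
proof -
  have "cos (2 * pi * t) = cos (2 * pi * \<bar>t\<bar>)"
    by (cases "t \<ge> 0") auto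
  moreover have "2 * pi * b \<le> pi" "2 * pi * \<bar>t\<bar> \<le> pi" using assms by (simp_all add: field_simps)
  ultimately show ?thesis using assms by (simp add: cos_mono_le_eq)
qed

lemma nearest_turn:
  obtains n :: int and r where "t = r + of_int n" "\<bar>r\<bar> \<le> 1/2"
    "cos (2 * pi * t) = cos (2 * pi * r)" "sin (2 * pi * t) = sin (2 * pi * r)"
proof
  show "t = (t - of_int (round t)) + of_int (round t)" by simp
  show "\<bar>t - of_int (round t)\<bar> \<le> 1/2" using of_int_round_abs_le[of t] by (simp add: abs_minus_commute)
  have "t - (t - of_int (round t)) \<in> \<int>" by simp
  then show "cos (2 * pi * t) = cos (2 * pi * (t - of_int (round t)))"
    "sin (2 * pi * t) = sin (2 * pi * (t - of_int (round t)))"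
    unfolding sin_cos_turns_eq_iff[symmetric] by blast+
qed

text \<open>
  The circles of radius \<open>1\<close> around \<open>3/2\<close> and \<open>-3/2\<close> are in the unit disk where the cosine
  of the parameter angle is at least \<open>3/4\<close>, that is, up to a fraction \<open>half_width\<close> of a full
  turn to both sides of the point closest to the origin.
\<close>

definition half_width :: real where "half_width = arccos (3/4) / (2 * pi)"

lemma half_width: "0 < half_width" "half_width < 1/4" "cos (2 * pi * half_width) = 3/4"
proof -
  have "arccos (3/4) > 0" using arccos_lt_bounded[of "3/4"] by simp
  then show "0 < half_width" by (simp add: half_width_def)
  have "arccos (3/4) < arccos 0" by (rule arccos_less_arccos) auto
  then show "half_width < 1/4" by (simp add: half_width_def field_simps)
  show "cos (2 * pi * half_width) = 3/4" by (simp add: half_width_def)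
qed

text \<open>
  The first curve is the circle of radius \<open>1\<close> around \<open>3/2\<close>, traversed clockwise from its
  leftmost point.
\<close>

definition crosses :: "(real \<Rightarrow> real) \<Rightarrow> real \<Rightarrow> real \<Rightarrow> bool" where
  "crosses X s t \<longleftrightarrow> graph_curve (\<lambda>u. 3/2 - u) s = graph_curve X t"

definition two_curves :: "(real \<Rightarrow> real) \<Rightarrow> diagram" where
  "two_curves X = \<lparr>curves = [graph_curve (\<lambda>u. 3/2 - u), graph_curve X],
     over = {(0, s) | s t. crosses X s t}\<rparr>"

lemma points_two_curves: "points (two_curves X) = {(i, t). i = 0 \<or> i = 1}"
  by (auto simp: points_def two_curves_def less_2_cases_iff)

context
  fixes X X' :: "real \<Rightarrow> real"
  assumes X_Ck: "\<And>n. Ck n X" and X_deriv: "\<And>u. (X has_real_derivative X' u) (at u)"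
    and X'_pos: "\<And>u. X' u > 0"
begin

lemma X_less: "u < v \<Longrightarrow> X u < X v"
  by (rule DERIV_pos_imp_increasing) (use X_deriv X'_pos in blast)+

lemma X_inj: "inj_on X {-1..1}"
  by (intro inj_onI) (metis X_less less_irrefl linorder_less_linear)

lemma double_pair_two_curves:
  "double_pair (two_curves X) p q \<longleftrightarrow>
     (\<exists>s t. crosses X s t \<and> (p = (0, s) \<and> q = (1, t) \<or> p = (1, t) \<and> q = (0, s)))"
proof -
  have inj0: "inj_on (\<lambda>u::real. 3/2 - u) {-1..1}" by (auto simp: inj_on_def)
  obtain i s j t where pq: "p = (i, s)" "q = (j, t)" by (cases p, cases q)
  have pos: "position (two_curves X) (0, r) = graph_curve (\<lambda>u. 3/2 - u) r"
    "position (two_curves X) (Suc 0, r) = graph_curve X r" for r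
    by (simp_all add: two_curves_def)
  have sym: "s - t \<in> \<int>" if "graph_curve Y s = graph_curve Y t" "Y \<in> {X, \<lambda>u. 3/2 - u}" for Y
    using that graph_curve_eq_iff[OF inj0] graph_curve_eq_iff[OF X_inj] by blast
  have "(i = 0 \<or> i = 1) \<and> (j = 0 \<or> j = 1) \<and> \<not> (i = j \<and> s - t \<in> \<int>) \<and>
      position (two_curves X) (i, s) = position (two_curves X) (j, t) \<longleftrightarrow>
      crosses X s t \<and> i = 0 \<and> j = 1 \<or> crosses X t s \<and> i = 1 \<and> j = 0"
  proof (cases "(i = 0 \<or> i = 1) \<and> (j = 0 \<or> j = 1)")
    case True
    then consider "i = 0" "j = 0" | "i = 0" "j = 1" | "i = 1" "j = 0" | "i = 1" "j = 1" by blast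
    then show ?thesis
      by cases (use sym in \<open>auto simp: pos crosses_def simp del: position.simps\<close>)
  qed auto
  then show ?thesis
    unfolding pq double_pair_def points_two_curves same_point.simps by auto
qed

lemma crossing_two_curves:
  "crossing (two_curves X) p q \<longleftrightarrow> (\<exists>s t. crosses X s t \<and> p = (0, s) \<and> q = (1, t))"
  unfolding crossing_def double_pair_two_curves by (auto simp: two_curves_def)

text \<open>
  At equal parameter angles the vertical components of the two velocities agree and the horizontal
  ones have opposite signs. So where the cosine is positive, a crossing has sign \<open>+\<close> on the
  upper half and \<open>-\<close> on the lower half.
\<close>

lemma det2_two_curves:
  assumes "sin (2 * pi * s) = sin (2 * pi * t)" "cos (2 * pi * s) = cos (2 * pi * t)"
  shows "det2 (direction (two_curves X) (0, s)) (direction (two_curves X) (1, t)) =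
    (2 * pi)\<^sup>2 * cos (2 * pi * t) * (1 + X' (cos (2 * pi * t))) * sin (2 * pi * t)"
proof -
  have d: "((\<lambda>u. 3/2 - u) has_real_derivative -1) (at u)" for u :: real
    by (auto intro!: derivative_eq_intros)
  have "direction (two_curves X) (0, s) = vector_derivative (graph_curve (\<lambda>u. 3/2 - u)) (at s)"
    "direction (two_curves X) (1, t) = vector_derivative (graph_curve X) (at t)"
    by (simp_all add: two_curves_def)
  then show ?thesis
    unfolding graph_curve_derivative[OF X_deriv] graph_curve_derivative[OF d] det2_def
    by (simp only: complex.sel assms) (simp add: power2_eq_square algebra_simps)
qed

lemma is_diagram_two_curves:
  assumes cr: "\<And>s t. crosses X s t \<Longrightarrow> s - t \<in> \<int> \<and> 0 < cos (2 * pi * t) \<and> cos (2 * pi * t) < 1"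
  shows "is_diagram (two_curves X)"
proof -
  have d: "((\<lambda>u. 3/2 - u) has_real_derivative -1) (at u)" for u :: real
    by (auto intro!: derivative_eq_intros)
  have ck: "Ck n (\<lambda>u::real. 3/2 - u)" for n
    using Ck_add[OF Ck_const[of n "3/2"] Ck_linear[of n "-1"]] by simp
  have period: "graph_curve Y (t + 1) = graph_curve Y t" for Y t
    using sin_cos_turns_eq_iff[of "t + 1" t] by (simp add: graph_curve_def)
  have regular: "vector_derivative (graph_curve Y) (at t) \<noteq> 0"
    if "\<And>u. (Y has_real_derivative Y' u) (at u)" "\<And>u. Y' u \<noteq> 0" for Y Y' t
  proof
    assume "vector_derivative (graph_curve Y) (at t) = 0"
    then have "sin (2 * pi * t) = 0" "cos (2 * pi * t) = 0"
      unfolding graph_curve_derivative[OF that(1)] using that(2) by (auto simp: complex_eq_iff)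
    then show False using sin_cos_squared_add[of "2 * pi * t"] by simp
  qed
  have transversal: "det2 (direction (two_curves X) (0, s)) (direction (two_curves X) (1, t)) \<noteq> 0"
    if "crosses X s t" for s t
  proof -
    note c = cr[OF that]
    have "sin (2 * pi * t) \<noteq> 0"
    proof
      assume "sin (2 * pi * t) = 0"
      then have "(cos (2 * pi * t))\<^sup>2 = 1" using sin_cos_squared_add[of "2 * pi * t"] by simp
      then show False using c by (auto simp: power2_eq_1_iff)
    qed
    moreover have "1 + X' (cos (2 * pi * t)) > 0" using X'_pos by (simp add: add_pos_pos)
    moreover have "sin (2 * pi * s) = sin (2 * pi * t)" "cos (2 * pi * s) = cos (2 * pi * t)"
      using c sin_cos_turns_eq_iff[of s t] by auto
    ultimately show ?thesis
      using c det2_two_curves by simp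
  qed
  have anti: "det2 u v = - det2 v u" for u v by (simp add: det2_def)
  have X'_ne: "X' u \<noteq> 0" for u using X'_pos[of u] by simp
  have 1: "\<forall>\<gamma> \<in> set (curves (two_curves X)). smooth_on UNIV \<gamma> \<and>
        (\<forall>t. \<gamma> (t + 1) = \<gamma> t \<and> vector_derivative \<gamma> (at t) \<noteq> 0)"
    using graph_curve_smooth[OF X_Ck] graph_curve_smooth[OF ck] period
      regular[OF X_deriv X'_ne] regular[OF d]
    by (simp add: two_curves_def)
  have 2: "\<forall>p q. double_pair (two_curves X) p q \<longrightarrow>
      det2 (direction (two_curves X) p) (direction (two_curves X) q) \<noteq> 0"
    unfolding double_pair_two_curves using transversal anti by (metis neg_equal_0_iff_equal)
  have 3: "\<not> (\<exists>p q r. double_pair (two_curves X) p q \<and> double_pair (two_curves X) q r \<and>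
      double_pair (two_curves X) p r)"
    unfolding double_pair_two_curves by auto
  have 4: "\<forall>p q. double_pair (two_curves X) p q \<longrightarrow>
      (p \<in> over (two_curves X) \<longleftrightarrow> q \<notin> over (two_curves X))"
    unfolding double_pair_two_curves by (auto simp: two_curves_def)
  have 5: "over (two_curves X) \<subseteq> {p. \<exists>q. double_pair (two_curves X) p q}"
    unfolding double_pair_two_curves by (auto simp: two_curves_def)
  show ?thesis unfolding is_diagram_def using 1 2 3 4 5 by blast
qed

lemma embedded_arc_two_curves:
  "i \<le> 1 \<Longrightarrow> embedded_arc (two_curves X) (i, - half_width, half_width)"
proof -
  have inj0: "inj_on (\<lambda>u::real. 3/2 - u) {-1..1}" by (auto simp: inj_on_def)
  have "s = t" if "s - t \<in> \<int>" "s \<in> {- half_width..half_width}" "t \<in> {- half_width..half_width}" for s t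
  proof -
    have "\<bar>s - t\<bar> < 1" using that half_width(2) by auto
    with that(1) show ?thesis using Ints_nonzero_abs_less1 by force
  qed
  then have "inj_on (graph_curve Y) {- half_width..half_width}" if "inj_on Y {-1..1}" for Y
    using graph_curve_eq_iff[OF that] by (intro inj_onI) auto
  from this[OF inj0] this[OF X_inj] show "i \<le> 1 \<Longrightarrow> ?thesis"
    by (auto simp: two_curves_def le_Suc_eq)
qed

end

text \<open>
  Hence a point is in the unit disk if and only if \<open>\<bar>X u\<bar> \<le> \<bar>u\<bar>\<close> for the cosine \<open>u\<close>.
\<close>

lemma norm_graph_curve: "(norm (graph_curve X t))\<^sup>2 = (X (cos (2 * pi * t)))\<^sup>2 + 1 - (cos (2 * pi * t))\<^sup>2"
  by (simp add: graph_curve_def cmod_power2 sin_squared_eq)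

lemma arcs_in_two_curves:
  assumes X: "\<And>u. u \<le> 1 \<Longrightarrow> 3/4 < u \<Longrightarrow> (X u)\<^sup>2 < u\<^sup>2" "(X (3/4))\<^sup>2 = (3/4)\<^sup>2"
    "\<And>u. u < 3/4 \<Longrightarrow> (X u)\<^sup>2 > u\<^sup>2"
  shows "arcs_in (cball 0 1) [(0, - half_width, half_width), (1, - half_width, half_width)] (two_curves X)"
proof -
  let ?a = half_width
  have X0: "u \<le> 1 \<Longrightarrow> 3/4 < u \<Longrightarrow> (3/2 - u)\<^sup>2 < u\<^sup>2" "(3/2 - 3/4 :: real)\<^sup>2 = (3/4)\<^sup>2"
    "u < 3/4 \<Longrightarrow> (3/2 - u)\<^sup>2 > u\<^sup>2" for u :: real
    by (auto simp: power2_eq_square algebra_simps)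
  have main: "graph_curve Y ?a \<in> sphere 0 1 \<and> graph_curve Y (- ?a) \<in> sphere 0 1 \<and>
      graph_curve Y ` {- ?a<..<?a} \<subseteq> ball 0 1 \<and>
      (\<forall>t. norm (graph_curve Y t) \<le> 1 \<longleftrightarrow> (\<exists>r m. t = r + of_int m \<and> - ?a \<le> r \<and> r \<le> ?a))"
    if Y: "\<And>u. u \<le> 1 \<Longrightarrow> 3/4 < u \<Longrightarrow> (Y u)\<^sup>2 < u\<^sup>2" "(Y (3/4))\<^sup>2 = (3/4)\<^sup>2"
      "\<And>u. u < 3/4 \<Longrightarrow> (Y u)\<^sup>2 > u\<^sup>2" for Y
  proof -
    have lt: "norm (graph_curve Y t) < 1 \<longleftrightarrow> 3/4 < cos (2 * pi * t)"
      and eq: "norm (graph_curve Y t) = 1 \<longleftrightarrow> cos (2 * pi * t) = 3/4" for t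
    proof -
      let ?u = "cos (2 * pi * t)"
      have n: "norm (graph_curve Y t) < 1 \<longleftrightarrow> (Y ?u)\<^sup>2 < ?u\<^sup>2"
        "norm (graph_curve Y t) = 1 \<longleftrightarrow> (Y ?u)\<^sup>2 = ?u\<^sup>2"
        using norm_graph_curve[of Y t] abs_square_less_1[of "norm (graph_curve Y t)"]
          power2_eq_1_iff[of "norm (graph_curve Y t)"] norm_ge_zero[of "graph_curve Y t"]
        by (auto simp del: norm_ge_zero)
      consider "?u < 3/4" | "?u = 3/4" | "?u > 3/4" by linarith
      then have "((Y ?u)\<^sup>2 < ?u\<^sup>2 \<longleftrightarrow> 3/4 < ?u) \<and> ((Y ?u)\<^sup>2 = ?u\<^sup>2 \<longleftrightarrow> ?u = 3/4)"
      proof cases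
        case 1
        then show ?thesis using Y(3)[of ?u] by auto
      next
        case 2
        then show ?thesis unfolding 2 using Y(2) by simp
      next
        case 3
        then show ?thesis using Y(1)[of ?u] by auto
      qed
      then show "norm (graph_curve Y t) < 1 \<longleftrightarrow> 3/4 < ?u" "norm (graph_curve Y t) = 1 \<longleftrightarrow> ?u = 3/4"
        unfolding n by blast+
    qed
    have le: "norm (graph_curve Y t) \<le> 1 \<longleftrightarrow> 3/4 \<le> cos (2 * pi * t)" for t
      using lt[of t] eq[of t] by (auto simp: le_less)
    have near: "3/4 \<le> cos (2 * pi * t) \<longleftrightarrow> \<bar>t\<bar> \<le> ?a" "3/4 < cos (2 * pi * t) \<longleftrightarrow> \<bar>t\<bar> < ?a" if "\<bar>t\<bar> \<le> 1/2" for t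
    proof -
      show "3/4 < cos (2 * pi * t) \<longleftrightarrow> \<bar>t\<bar> < ?a"
        using cos_turn_le_iff[OF that, of ?a] half_width by auto
      show "3/4 \<le> cos (2 * pi * t) \<longleftrightarrow> \<bar>t\<bar> \<le> ?a"
        using cos_turn_le_iff[of ?a "\<bar>t\<bar>"] half_width that by (cases "t \<ge> 0") auto
    qed
    have "norm (graph_curve Y t) \<le> 1 \<longleftrightarrow> (\<exists>r m. t = r + of_int m \<and> - ?a \<le> r \<and> r \<le> ?a)" for t
    proof
      assume "norm (graph_curve Y t) \<le> 1"
      then have *: "3/4 \<le> cos (2 * pi * t)" by (simp add: le)
      obtain n r where "t = r + of_int n" "\<bar>r\<bar> \<le> 1/2" "cos (2 * pi * t) = cos (2 * pi * r)"
        using nearest_turn by blast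
      with * near(1)[of r] show "\<exists>r m. t = r + of_int m \<and> - ?a \<le> r \<and> r \<le> ?a"
        by (intro exI[of _ r] exI[of _ n]) auto
    next
      assume "\<exists>r m. t = r + of_int m \<and> - ?a \<le> r \<and> r \<le> ?a"
      then obtain r m where r: "t = r + of_int m" "\<bar>r\<bar> \<le> ?a" by auto
      then have "t - r \<in> \<int>" by simp
      then have "cos (2 * pi * t) = cos (2 * pi * r)" unfolding sin_cos_turns_eq_iff[symmetric] by blast
      then show "norm (graph_curve Y t) \<le> 1" using r near(1)[of r] half_width by (simp add: le)
    qed
    moreover have "graph_curve Y ` {- ?a<..<?a} \<subseteq> ball 0 1"
      using lt near(2) half_width by (auto simp: dist_norm)
    moreover have "graph_curve Y ?a \<in> sphere 0 1" "graph_curve Y (- ?a) \<in> sphere 0 1"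
      using eq[of ?a] eq[of "- ?a"] half_width by auto
    ultimately show ?thesis by blast
  qed
  note m0 = main[of "\<lambda>u. 3/2 - u", OF X0] and m1 = main[of X, OF X]
  have le0: "norm (graph_curve (\<lambda>u. 3/2 - u) t) \<le> 1 \<longleftrightarrow> (\<exists>r m. t = r + of_int m \<and> - ?a \<le> r \<and> r \<le> ?a)"
    and le1: "norm (graph_curve X t) \<le> 1 \<longleftrightarrow> (\<exists>r m. t = r + of_int m \<and> - ?a \<le> r \<and> r \<le> ?a)" for t
    using m0 m1 by blast+
  show ?thesis
    unfolding arcs_in_def
  proof (intro conjI)
    show "\<forall>(i, a, b) \<in> set [(0, - ?a, ?a), (1, - ?a, ?a)]. i < length (curves (two_curves X)) \<and> a < b \<and> b < a + 1 \<and>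
        (curves (two_curves X) ! i) a \<in> frontier (cball 0 1) \<and> (curves (two_curves X) ! i) b \<in> frontier (cball 0 1) \<and>
        (curves (two_curves X) ! i) ` {a<..<b} \<subseteq> interior (cball 0 1)"
      using m0 m1 half_width by (simp add: two_curves_def)
    show "sorted_wrt (\<lambda>A B. disjnt (arc_points A) (arc_points B)) [(0, - ?a, ?a), (1, - ?a, ?a)]"
      by (auto simp: disjnt_iff)
    show "{p \<in> points (two_curves X). position (two_curves X) p \<in> cball 0 1} =
        (\<Union>A \<in> set [(0, - ?a, ?a), (1, - ?a, ?a)]. arc_points A)"
    proof -
      have "(p \<in> points (two_curves X) \<and> position (two_curves X) p \<in> cball 0 1) \<longleftrightarrow>
          p \<in> arc_points (0, - ?a, ?a) \<or> p \<in> arc_points (1, - ?a, ?a)" for p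
      proof -
        obtain i t where p: "p = (i, t)" by (cases p)
        have "p \<in> points (two_curves X) \<and> position (two_curves X) p \<in> cball 0 1 \<longleftrightarrow>
            i = 0 \<and> norm (graph_curve (\<lambda>u. 3/2 - u) t) \<le> 1 \<or> i = 1 \<and> norm (graph_curve X t) \<le> 1"
          unfolding p points_two_curves by (auto simp: two_curves_def)
        also have "\<dots> \<longleftrightarrow> p \<in> arc_points (0, - ?a, ?a) \<or> p \<in> arc_points (1, - ?a, ?a)"
          unfolding le0 le1 p arc_points.simps by auto
        finally show ?thesis .
      qed
      then show ?thesis by auto
    qed
  qed
qed


abbreviation left_circle :: "real \<Rightarrow> real" where "left_circle \<equiv> \<lambda>u. u - 3/2"

abbreviation finger :: "real \<Rightarrow> real" where "finger \<equiv> \<lambda>u. u + bump u - 3/2"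

text \<open>
  The cosine at which the finger crosses the other circle: \<open>2 * u + bump u = 3\<close> says that the
  horizontal coordinates \<open>u + bump u - 3/2\<close> and \<open>3/2 - u\<close> are equal.
\<close>

definition meet_cos :: real where
  "meet_cos = (SOME u. 3/4 < u \<and> u < 1 \<and> 2 * u + bump u = 3)"

lemma meet_cos: "3/4 < meet_cos" "meet_cos < 1" "2 * meet_cos + bump meet_cos = 3"
proof -
  have "continuous_on {3/4..1} (\<lambda>u. 2 * u + bump u)"
    using bump_has_derivative DERIV_isCont
    by (intro continuous_intros continuous_at_imp_continuous_on) blast
  then obtain u where u: "3/4 \<le> u" "u \<le> 1" "2 * u + bump u = 3"
    using IVT'[of "\<lambda>u. 2 * u + bump u" "3/4" 3 1] bump_eq_0[of "3/4"] bump_1 by auto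
  moreover have "u \<noteq> 3/4"
  proof
    assume "u = 3/4"
    with u(3) bump_eq_0[of "3/4"] show False by simp
  qed
  moreover have "u \<noteq> 1" using u(3) bump_1 by auto
  ultimately have "3/4 < u \<and> u < 1 \<and> 2 * u + bump u = 3" by simp
  then have "3/4 < meet_cos \<and> meet_cos < 1 \<and> 2 * meet_cos + bump meet_cos = 3"
    unfolding meet_cos_def by (rule someI)
  then show "3/4 < meet_cos" "meet_cos < 1" "2 * meet_cos + bump meet_cos = 3" by auto
qed

lemma meet_cos_iff: "2 * u + bump u \<ge> 3 \<longleftrightarrow> u \<ge> meet_cos" "2 * u + bump u = 3 \<longleftrightarrow> u = meet_cos"
proof -
  consider "u < meet_cos" | "u = meet_cos" | "u > meet_cos" by linarith
  then show "2 * u + bump u \<ge> 3 \<longleftrightarrow> u \<ge> meet_cos" "2 * u + bump u = 3 \<longleftrightarrow> u = meet_cos"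
    using meet_cos(3) bump_mono[of u meet_cos] bump_mono[of meet_cos u] by (cases; simp)+
qed

definition meet_turn :: real where "meet_turn = arccos meet_cos / (2 * pi)"

lemma meet_turn: "0 < meet_turn" "meet_turn < half_width" "cos (2 * pi * meet_turn) = meet_cos"
proof -
  have "arccos meet_cos > 0" using arccos_lt_bounded[of meet_cos] meet_cos by simp
  then show "0 < meet_turn" by (simp add: meet_turn_def)
  have "arccos meet_cos < arccos (3/4)" by (rule arccos_less_arccos) (use meet_cos in auto)
  then show "meet_turn < half_width" by (simp add: meet_turn_def half_width_def field_simps)
  show "cos (2 * pi * meet_turn) = meet_cos" using meet_cos by (simp add: meet_turn_def)
qed

lemma cos_turn_meet_iff:
  assumes "\<bar>t\<bar> \<le> 1/2"
  shows "cos (2 * pi * t) \<ge> meet_cos \<longleftrightarrow> \<bar>t\<bar> \<le> meet_turn"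
    and "cos (2 * pi * t) = meet_cos \<longleftrightarrow> \<bar>t\<bar> = meet_turn"
proof -
  have 1: "cos (2 * pi * t) \<le> meet_cos \<longleftrightarrow> meet_turn \<le> \<bar>t\<bar>"
    using cos_turn_le_iff[OF assms, of meet_turn] meet_turn half_width by simp
  have 2: "cos (2 * pi * t) \<ge> meet_cos \<longleftrightarrow> \<bar>t\<bar> \<le> meet_turn"
    using cos_turn_le_iff[of meet_turn "\<bar>t\<bar>"] meet_turn half_width assms by (cases "t \<ge> 0") auto
  show "cos (2 * pi * t) \<ge> meet_cos \<longleftrightarrow> \<bar>t\<bar> \<le> meet_turn" by (rule 2)
  show "cos (2 * pi * t) = meet_cos \<longleftrightarrow> \<bar>t\<bar> = meet_turn" using 1 2 by linarith
qed

lemma left_circle_regular: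
  "Ck n left_circle" "(left_circle has_real_derivative 1) (at u)" "(1::real) > 0"
proof -
  show "Ck n left_circle" using Ck_add[OF Ck_linear[of n 1] Ck_const[of n "-3/2"]] by simp
qed (auto intro!: derivative_eq_intros)

lemma finger_regular:
  "Ck n finger" "(finger has_real_derivative 1 + bump' u) (at u)" "1 + bump' u > 0"
proof -
  show "Ck n finger"
    using Ck_add[OF Ck_add[OF Ck_linear[of n 1] Ck_bump[of n]] Ck_const[of n "-3/2"]] by simp
  show "(finger has_real_derivative 1 + bump' u) (at u)"
    by (auto intro!: derivative_eq_intros bump_has_derivative)
  show "1 + bump' u > 0" using bump'_nonneg[of u] by simp
qed

lemma crosses_left_circle: "\<not> crosses left_circle s t"
proof
  assume "crosses left_circle s t"
  then have "cos (2 * pi * s) + cos (2 * pi * t) = 3"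
    by (simp add: crosses_def graph_curve_def algebra_simps)
  then show False using cos_le_one[of "2 * pi * s"] cos_le_one[of "2 * pi * t"] by linarith
qed

text \<open>
  Equal heights mean equal cosines up to sign. Opposite cosines would need a finger of length \<open>3\<close>,
  so the curves meet only at equal angles.
\<close>

lemma crosses_finger: "crosses finger s t \<longleftrightarrow> s - t \<in> \<int> \<and> cos (2 * pi * t) = meet_cos"
proof
  assume cr: "crosses finger s t"
  then have x: "3/2 - cos (2 * pi * s) = cos (2 * pi * t) + bump (cos (2 * pi * t)) - 3/2"
    and y: "sin (2 * pi * s) = sin (2 * pi * t)" by (simp_all add: crosses_def graph_curve_def)
  have "(cos (2 * pi * s))\<^sup>2 = (cos (2 * pi * t))\<^sup>2" using y by (simp add: cos_squared_eq)
  then have "cos (2 * pi * s) = cos (2 * pi * t) \<or> cos (2 * pi * s) = - cos (2 * pi * t)"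
    by (simp add: power2_eq_iff)
  moreover have "cos (2 * pi * s) \<noteq> - cos (2 * pi * t)"
    using x bump_le[of "cos (2 * pi * t)"] by auto
  ultimately have eq: "cos (2 * pi * s) = cos (2 * pi * t)" by blast
  then have "2 * cos (2 * pi * t) + bump (cos (2 * pi * t)) = 3" using x by linarith
  with y eq show "s - t \<in> \<int> \<and> cos (2 * pi * t) = meet_cos"
    using meet_cos_iff(2) sin_cos_turns_eq_iff[of s t] by auto
next
  assume "s - t \<in> \<int> \<and> cos (2 * pi * t) = meet_cos"
  then show "crosses finger s t"
    using sin_cos_turns_eq_iff[of s t] meet_cos(3) by (simp add: crosses_def graph_curve_def)
qed

abbreviation before :: diagram where "before \<equiv> two_curves left_circle"
abbreviation after :: diagram where "after \<equiv> two_curves finger"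

lemma is_diagram_before: "is_diagram before"
  by (rule is_diagram_two_curves[OF left_circle_regular]) (use crosses_left_circle in blast)

lemma is_diagram_after: "is_diagram after"
proof (rule is_diagram_two_curves[OF finger_regular])
  show "s - t \<in> \<int> \<and> 0 < cos (2 * pi * t) \<and> cos (2 * pi * t) < 1" if "crosses finger s t" for s t
    using that meet_cos unfolding crosses_finger by auto
qed

lemma crossing_sign_after:
  assumes "crosses finger s t"
  shows "crossing_sign after (0, s) (1, t) = (if sin (2 * pi * t) > 0 then Pos else Neg)"
proof -
  have "s - t \<in> \<int>" and c: "cos (2 * pi * t) > 0" using assms meet_cos unfolding crosses_finger by auto
  then have eq: "sin (2 * pi * s) = sin (2 * pi * t)" "cos (2 * pi * s) = cos (2 * pi * t)"
    using sin_cos_turns_eq_iff by blast+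
  have "(2 * pi)\<^sup>2 * cos (2 * pi * t) * (1 + (1 + bump' (cos (2 * pi * t)))) > 0"
    using c bump'_nonneg[of "cos (2 * pi * t)"] by (intro mult_pos_pos) auto
  then have "0 < det2 (direction after (0, s)) (direction after (1, t)) \<longleftrightarrow> 0 < sin (2 * pi * t)"
    unfolding det2_two_curves[OF finger_regular eq]
    by (metis mult_pos_pos zero_less_mult_pos)
  then show ?thesis
    unfolding crossing_sign_def by (simp del: direction.simps)
qed

lemma passages_after:
  "passages k e after = {u. cos (2 * pi * u) = meet_cos \<and> (sin (2 * pi * u) > 0 \<longleftrightarrow> e = Pos)}"
proof -
  have same: "sin (2 * pi * s) = sin (2 * pi * t) \<and> cos (2 * pi * s) = cos (2 * pi * t)"
    if "crosses finger s t" for s t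
    using that sin_cos_turns_eq_iff unfolding crosses_finger by blast
  have sign: "(if b then Pos else Neg) = e \<longleftrightarrow> (b \<longleftrightarrow> e = Pos)" for b by (cases e) auto
  have meets: "crossing after (0, s) (1, t) \<and> crossing_sign after (0, s) (1, t) = e \<longleftrightarrow>
      crosses finger s t \<and> (sin (2 * pi * t) > 0 \<longleftrightarrow> e = Pos)" for s t
  proof -
    have cross: "crossing after (0, s) (1, t) \<longleftrightarrow> crosses finger s t"
      unfolding crossing_two_curves[OF finger_regular] by blast
    show ?thesis
    proof (cases "crosses finger s t")
      case True
      show ?thesis unfolding cross crossing_sign_after[OF True] sign ..
    next
      case False
      then show ?thesis unfolding cross by blast
    qed
  qed
  have "u \<in> passages k e after \<longleftrightarrow> cos (2 * pi * u) = meet_cos \<and> (sin (2 * pi * u) > 0 \<longleftrightarrow> e = Pos)" for u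
  proof
    assume "u \<in> passages k e after"
    then obtain v where v: "meets k e after u v" by (auto simp: passages_def)
    show "cos (2 * pi * u) = meet_cos \<and> (sin (2 * pi * u) > 0 \<longleftrightarrow> e = Pos)"
    proof (cases "k = 0")
      case True
      then have "crosses finger u v \<and> (sin (2 * pi * v) > 0 \<longleftrightarrow> e = Pos)"
        using v unfolding meets_def meets[symmetric] by simp
      then show ?thesis using same[of u v] unfolding crosses_finger by metis
    next
      case False
      then have "crosses finger v u \<and> (sin (2 * pi * u) > 0 \<longleftrightarrow> e = Pos)"
        using v unfolding meets_def meets[symmetric] by simp
      then show ?thesis unfolding crosses_finger by blast
    qed
  next
    assume "cos (2 * pi * u) = meet_cos \<and> (sin (2 * pi * u) > 0 \<longleftrightarrow> e = Pos)"
    then have "crossing after (0, u) (1, u) \<and> crossing_sign after (0, u) (1, u) = e"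
      unfolding meets crosses_finger by simp
    then have "meets k e after u u" by (simp add: meets_def)
    then show "u \<in> passages k e after" by (auto simp: passages_def)
  qed
  then show ?thesis by blast
qed

lemma passages_before: "passages k e before = {}"
  using crosses_left_circle
  by (auto simp: passages_def meets_def crossing_two_curves[OF left_circle_regular] split: if_splits)

lemma embedded_disk_unit: "embedded_disk (cball 0 1)"
proof -
  have "inv (\<lambda>z::complex. z) = (\<lambda>z. z)" using inv_id by (simp add: id_def)
  then have "diffeo (\<lambda>z. z)"
    by (simp add: diffeo_def smooth_on_ident bij_def)
  then show ?thesis unfolding embedded_disk_def by (intro exI[of _ "\<lambda>z. z"]) simp
qed

abbreviation arcs :: "arc list" where
  "arcs \<equiv> [(0, - half_width, half_width), (1, - half_width, half_width)]"

lemma arcs_in_before: "arcs_in (cball 0 1) arcs before"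
  by (rule arcs_in_two_curves) (auto simp: power2_eq_square algebra_simps)

lemma arcs_in_after: "arcs_in (cball 0 1) arcs after"
proof (rule arcs_in_two_curves)
  show "(finger u)\<^sup>2 < u\<^sup>2" if "u \<le> 1" "3/4 < u" for u
  proof -
    have "\<bar>finger u\<bar> < \<bar>u\<bar>" using that bump_nonneg[of u] bump_le[of u] by auto
    then show ?thesis by (meson abs_le_square_iff not_le)
  qed
qed (auto simp: bump_eq_0 power2_eq_square algebra_simps)

lemma replacement_before_after: "replacement (cball 0 1) arcs before after"
proof -
  have "position after p = position before p \<and> (p \<in> over after \<longleftrightarrow> p \<in> over before)"
    if p: "p \<in> points before - (\<Union>A \<in> set arcs. arc_points A)" for p
  proof -
    obtain i t where it: "p = (i, t)" by (cases p)
    have arcs: "{p \<in> points after. position after p \<in> cball 0 1} = (\<Union>A \<in> set arcs. arc_points A)"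
      using arcs_in_after by (simp add: arcs_in_def)
    have i: "i = 0 \<or> i = 1" and "(i, t) \<notin> (\<Union>A \<in> set arcs. arc_points A)"
      using p unfolding it points_two_curves by auto
    then have "(1, t) \<notin> (\<Union>A \<in> set arcs. arc_points A)" by auto
    moreover have "(1, t) \<in> points after" unfolding points_two_curves by simp
    ultimately have "position after (1, t) \<notin> cball 0 1" using arcs by blast
    then have "1 < norm (graph_curve finger t)" by (simp add: two_curves_def)
    then have "1 < (norm (graph_curve finger t))\<^sup>2" by (simp add: one_less_power)
    then have "(cos (2 * pi * t))\<^sup>2 < (finger (cos (2 * pi * t)))\<^sup>2"
      unfolding norm_graph_curve by simp
    then have small: "cos (2 * pi * t) < 3/4"
      using bump_nonneg[of "cos (2 * pi * t)"] bump_le[of "cos (2 * pi * t)"]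
      unfolding not_le[symmetric] abs_le_square_iff[symmetric] by auto
    then have "finger (cos (2 * pi * t)) = left_circle (cos (2 * pi * t))"
      by (simp add: bump_eq_0)
    then have "position after p = position before p"
      using i by (auto simp: it two_curves_def graph_curve_def)
    moreover have "\<not> crosses finger t r" for r
    proof
      assume "crosses finger t r"
      then have "cos (2 * pi * t) = meet_cos"
        using sin_cos_turns_eq_iff[of t r] by (auto simp: crosses_finger)
      with small meet_cos(1) show False by simp
    qed
    ultimately show ?thesis
      using crosses_left_circle by (auto simp: it two_curves_def)
  qed
  then show ?thesis
    unfolding replacement_def
    using is_diagram_before is_diagram_after embedded_disk_unit arcs_in_before arcs_in_after
    by (simp add: two_curves_def)
qed

section \<open>The finger move is not generated\<close>

lemma crosses_finger_near:
  assumes "s \<in> {- half_width..half_width}" "t \<in> {- half_width..half_width}"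
  shows "crosses finger s t \<longleftrightarrow> s = meet_turn \<and> t = meet_turn \<or> s = - meet_turn \<and> t = - meet_turn"
proof -
  have "\<bar>t\<bar> \<le> 1/2" "\<bar>s - t\<bar> < 1" using assms half_width by auto
  then have "s - t \<in> \<int> \<longleftrightarrow> s = t" "cos (2 * pi * t) = meet_cos \<longleftrightarrow> \<bar>t\<bar> = meet_turn"
    using Ints_nonzero_abs_less1[of "s - t"] cos_turn_meet_iff(2) by auto
  then show ?thesis unfolding crosses_finger using meet_turn(1) by auto
qed

text \<open>
  The inside of the lens lies in every convex set that contains the boundary of the lens. The convex
  set \<open>K\<close> below, a part of the disk bounded by the first circle, contains the boundary of the lens
  but no further points of the two curves.
\<close>

lemma lens_empty:
  defines "S \<equiv> graph_curve (\<lambda>u. 3/2 - u) ` {- meet_turn..meet_turn} \<union>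
      graph_curve finger ` {- meet_turn..meet_turn}"
  shows "inside S \<inter> position after ` points after = {}"
proof -
  \<comment> \<open>the bound on the real part excludes the right half of the first circle\<close>
  define K where "K = cball (3/2) 1 \<inter> {z. Re z \<le> 1} \<inter> {z. Im z \<le> sin (2 * pi * meet_turn)} \<inter>
      {z. - sin (2 * pi * meet_turn) \<le> Im z}"
  have "convex K"
    unfolding K_def
    by (intro convex_Int convex_cball convex_halfspace_Re_le convex_halfspace_Im_le convex_halfspace_Im_ge)
  have unit: "(norm (Complex x y - 3/2) \<le> 1) \<longleftrightarrow> (x - 3/2)\<^sup>2 + y\<^sup>2 \<le> 1" for x y
  proof -
    have "(norm (Complex x y - 3/2))\<^sup>2 = (x - 3/2)\<^sup>2 + y\<^sup>2" by (simp add: cmod_power2)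
    moreover have "norm (Complex x y - 3/2) \<le> 1 \<longleftrightarrow> (norm (Complex x y - 3/2))\<^sup>2 \<le> 1"
      using abs_square_le_1[of "norm (Complex x y - 3/2)"] by simp
    ultimately show ?thesis by simp
  qed
  have right: "graph_curve (\<lambda>u. 3/2 - u) t \<in> cball (3/2) 1" for t
    using unit[of "3/2 - cos (2 * pi * t)" "sin (2 * pi * t)"]
    by (simp add: graph_curve_def dist_norm norm_minus_commute sin_squared_eq)
  have finger: "graph_curve finger t \<in> cball (3/2) 1 \<longleftrightarrow> cos (2 * pi * t) \<ge> meet_cos" for t
  proof -
    let ?u = "cos (2 * pi * t)"
    have "graph_curve finger t \<in> cball (3/2) 1 \<longleftrightarrow> (?u + bump ?u - 3/2 - 3/2)\<^sup>2 + (sin (2 * pi * t))\<^sup>2 \<le> 1"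
      using unit[of "?u + bump ?u - 3/2" "sin (2 * pi * t)"]
      by (simp add: graph_curve_def dist_norm norm_minus_commute)
    also have "\<dots> \<longleftrightarrow> \<bar>?u + bump ?u - 3\<bar> \<le> \<bar>?u\<bar>"
      unfolding abs_le_square_iff by (simp add: sin_squared_eq)
    also have "\<dots> \<longleftrightarrow> 2 * ?u + bump ?u \<ge> 3"
      using bump_le[of ?u] cos_le_one[of "2 * pi * t"] by auto
    finally show ?thesis by (simp add: meet_cos_iff)
  qed
  have near: "\<bar>sin (2 * pi * t)\<bar> \<le> sin (2 * pi * meet_turn) \<longleftrightarrow> \<bar>cos (2 * pi * t)\<bar> \<ge> meet_cos" for t
  proof -
    have "sin (2 * pi * meet_turn) \<ge> 0"
      using meet_turn half_width by (intro sin_ge_zero) auto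
    then have "\<bar>sin (2 * pi * t)\<bar> \<le> sin (2 * pi * meet_turn) \<longleftrightarrow>
        (sin (2 * pi * t))\<^sup>2 \<le> (sin (2 * pi * meet_turn))\<^sup>2"
      unfolding abs_le_square_iff[symmetric] by simp
    also have "\<dots> \<longleftrightarrow> (meet_cos)\<^sup>2 \<le> (cos (2 * pi * t))\<^sup>2"
      by (simp add: sin_squared_eq meet_turn)
    also have "\<dots> \<longleftrightarrow> \<bar>cos (2 * pi * t)\<bar> \<ge> meet_cos"
      unfolding abs_le_square_iff[symmetric] using meet_cos by simp
    finally show ?thesis .
  qed
  have cos_near: "cos (2 * pi * t) \<ge> meet_cos" if "t \<in> {- meet_turn..meet_turn}" for t
    using that cos_turn_meet_iff(1)[of t] meet_turn half_width by auto
  have "S \<subseteq> K"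
  proof
    fix z assume "z \<in> S"
    then obtain t where t: "cos (2 * pi * t) \<ge> meet_cos"
      and z: "z = graph_curve (\<lambda>u. 3/2 - u) t \<or> z = graph_curve finger t"
      unfolding S_def using cos_near by blast
    have "\<bar>sin (2 * pi * t)\<bar> \<le> sin (2 * pi * meet_turn)" using near[of t] t by simp
    then have "Im z \<le> sin (2 * pi * meet_turn)" "- sin (2 * pi * meet_turn) \<le> Im z"
      using z by (auto simp: graph_curve_def)
    moreover have "Re z \<le> 1"
    proof -
      have "finger (cos (2 * pi * t)) \<le> 1"
        using bump_le[OF cos_le_one, of "2 * pi * t"] cos_le_one[of "2 * pi * t"] by linarith
      then show ?thesis using z t meet_cos(1) by (auto simp: graph_curve_def)
    qed
    moreover have "z \<in> cball (3/2) 1" using z right finger t by blast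
    ultimately show "z \<in> K" by (simp add: K_def)
  qed
  then have inside: "inside S \<subseteq> K"
    using inside_mono[of S K] inside_convex[OF \<open>convex K\<close>] by blast
  have in_S: "graph_curve (\<lambda>u. 3/2 - u) t \<in> S \<and> graph_curve finger t \<in> S"
    if "cos (2 * pi * t) \<ge> meet_cos" for t
  proof -
    obtain r where r: "\<bar>r\<bar> \<le> 1/2" "cos (2 * pi * t) = cos (2 * pi * r)" "sin (2 * pi * t) = sin (2 * pi * r)"
      using nearest_turn[of t] by metis
    then have "r \<in> {- meet_turn..meet_turn}" using that cos_turn_meet_iff(1)[of r] by auto
    moreover have "graph_curve Y t = graph_curve Y r" for Y using r by (simp add: graph_curve_def)
    ultimately show ?thesis unfolding S_def by blast
  qed
  have "position after p \<notin> inside S" if "p \<in> points after" for p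
  proof
    assume ins: "position after p \<in> inside S"
    then have K: "position after p \<in> K" and nS: "position after p \<notin> S"
      using inside inside_no_overlap by blast+
    obtain i t where p: "p = (i, t)" by (cases p)
    consider "i = 0" | "i = 1" using \<open>p \<in> points after\<close> unfolding p points_two_curves by blast
    then show False
    proof cases
      case 1
      then have pos: "position after p = graph_curve (\<lambda>u. 3/2 - u) t"
        by (simp add: p two_curves_def)
      then have "\<bar>sin (2 * pi * t)\<bar> \<le> sin (2 * pi * meet_turn)" "3/2 - cos (2 * pi * t) \<le> 1"
        using K by (auto simp: K_def graph_curve_def)
      then have "cos (2 * pi * t) \<ge> meet_cos" unfolding near by auto
      then show False using in_S nS pos by simp
    next
      case 2
      then have pos: "position after p = graph_curve finger t"
        by (simp add: p two_curves_def)
      then have "cos (2 * pi * t) \<ge> meet_cos" using K finger by (simp add: K_def)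
      then show False using in_S nS pos by simp
    qed
  qed
  then show ?thesis by blast
qed

lemma bigon_after: "bigon (False, False) after (0, - half_width, half_width) (1, - half_width, half_width)"
proof -
  let ?a = half_width and ?m = meet_turn
  have curves: "curves after ! 0 = graph_curve (\<lambda>u. 3/2 - u)" "curves after ! 1 = graph_curve finger"
    by (simp_all add: two_curves_def)
  have sin: "sin (2 * pi * ?m) > 0"
    using meet_turn half_width by (intro sin_gt_zero) auto
  have self: "crosses finger ?m ?m" "crosses finger (- ?m) (- ?m)"
    by (simp_all add: crosses_finger meet_turn)
  have seg: "closed_segment ?m (- ?m) = {- ?m..?m}"
    using meet_turn by (simp add: closed_segment_eq_real_ivl)
  show ?thesis
    unfolding bigon_def prod.case curves
  proof (rule exI[of _ ?m], rule exI[of _ "- ?m"], rule exI[of _ ?m], rule exI[of _ "- ?m"],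
      intro conjI ballI)
    show "graph_curve (\<lambda>u. 3/2 - u) s = graph_curve finger t \<longleftrightarrow> s = ?m \<and> t = ?m \<or> s = - ?m \<and> t = - ?m"
      if "s \<in> {- ?a..?a}" "t \<in> {- ?a..?a}" for s t
      using crosses_finger_near[OF that] unfolding crosses_def .
    show "crossing after (0, ?m) (1, ?m)" "crossing after (0, - ?m) (1, - ?m)"
      using self unfolding crossing_two_curves[OF finger_regular] by blast+
    show "crossing_sign after (0, ?m) (1, ?m) = Pos" "crossing_sign after (0, - ?m) (1, - ?m) = Neg"
      unfolding crossing_sign_after[OF self(1)] crossing_sign_after[OF self(2)] using sin by simp_all
    show "inside (graph_curve (\<lambda>u. 3/2 - u) ` closed_segment ?m (- ?m) \<union>
        graph_curve finger ` closed_segment ?m (- ?m)) \<inter> position after ` points after = {}"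
      unfolding seg by (rule lens_empty)
  qed (use meet_turn in auto)
qed

lemma move2_before_after: "move2 (False, False) (cball 0 1) before after"
proof -
  have "disjoint_arcs before (0, - half_width, half_width) (1, - half_width, half_width)"
    using crosses_left_circle by (auto simp: two_curves_def disjnt_iff crosses_def)
  moreover have "embedded_arc before (i, - half_width, half_width)"
    "embedded_arc after (i, - half_width, half_width)" if "i \<le> 1" for i
    using that embedded_arc_two_curves[OF left_circle_regular] embedded_arc_two_curves[OF finger_regular]
    by blast+
  ultimately show ?thesis
    unfolding move2_def using replacement_before_after bigon_after
    by (intro exI conjI) (assumption | simp)+
qed

text \<open>
  The point of component \<open>k\<close> that is farthest from the unit disk, at parameter \<open>1/2\<close>.
\<close>

definition far_point :: "nat \<Rightarrow> complex" where
  "far_point k = (if k = 0 then 5/2 else - 5/2)"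

lemma far_point_outside: "far_point k \<notin> cball 0 1"
  by (simp add: far_point_def)

lemma based_ballot_before:
  assumes "k \<le> 1" shows "based_ballot k (far_point k) before"
proof -
  have "position before (k, 1/2) = far_point k"
    using assms by (auto simp: le_Suc_eq two_curves_def graph_curve_def far_point_def complex_eq_iff)
  then show ?thesis
    unfolding based_ballot_def passages_before
    by (auto simp: ballot_def two_curves_def intro!: exI[of _ "1/2"])
qed

text \<open>
  Both curves run upwards through the lens and start at their far points, so on both of them the
  negative crossing in the lower half comes first. The half turn after the base point contains this
  negative passage and no positive one.
\<close>

lemma not_based_ballot_after:
  assumes k: "k \<le> 1" shows "\<not> based_ballot k (far_point k) after"
proof
  assume "based_ballot k (far_point k) after"
  then obtain \<tau> where \<tau>: "position after (k, \<tau>) = far_point k"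
    "ballot (passages k Pos after) (passages k Neg after) \<tau> (\<tau> + 1)"
    by (auto simp: based_ballot_def simp del: position.simps)
  have "cos (2 * pi * \<tau>) = - 1"
  proof (cases "k = 0")
    case True
    then show ?thesis using \<tau>(1) by (simp add: two_curves_def graph_curve_def far_point_def complex_eq_iff)
  next
    case False
    then have "cos (2 * pi * \<tau>) + bump (cos (2 * pi * \<tau>)) = - 1"
      using \<tau>(1) k by (simp add: two_curves_def graph_curve_def far_point_def complex_eq_iff)
    then show ?thesis
      using bump_nonneg[of "cos (2 * pi * \<tau>)"] cos_ge_minus_one[of "2 * pi * \<tau>"] by linarith
  qed
  moreover obtain n r where r: "\<tau> = r + of_int n" "\<bar>r\<bar> \<le> 1/2" "cos (2 * pi * \<tau>) = cos (2 * pi * r)"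
    using nearest_turn by metis
  ultimately have "\<bar>r\<bar> \<ge> 1/2"
    using cos_turn_le_iff[of r "1/2"] by simp
  with r(2) have "r = 1/2 \<or> r = - 1/2" by linarith
  \<comment> \<open>the half turn that starts at \<open>\<tau>\<close> ends at an integer, in the middle of the lens\<close>
  then obtain m :: int where m: "\<tau> = of_int m - 1/2"
  proof
    assume "r = 1/2"
    then show thesis using that[of "n + 1"] r(1) by simp
  next
    assume "r = - 1/2"
    then show thesis using that[of n] r(1) by simp
  qed
  have shift: "sin (2 * pi * u) = sin (2 * pi * (u - of_int m))" for u
    using sin_cos_turns_eq_iff[of u "u - of_int m"] by simp
  have "passages k Pos after \<inter> {\<tau>..<\<tau> + 1/2} = {}"
  proof -
    have "sin (2 * pi * u) \<le> 0" if "u \<in> {\<tau>..<\<tau> + 1/2}" for u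
    proof -
      have "0 \<le> sin (2 * pi * x)" if "0 \<le> x" "x \<le> 1/2" for x
        using that by (intro sin_ge_zero) (auto simp: field_simps)
      then have "0 \<le> sin (2 * pi * (of_int m - u))"
        using that m by simp
      moreover have "2 * pi * (of_int m - u) = - (2 * pi * (u - of_int m))" by (simp add: algebra_simps)
      ultimately show ?thesis unfolding shift[of u] by simp
    qed
    then show ?thesis unfolding passages_after by fastforce
  qed
  moreover have "of_int m - meet_turn \<in> passages k Neg after \<inter> {\<tau>..<\<tau> + 1/2}"
  proof -
    have "cos (2 * pi * (of_int m - meet_turn)) = cos (2 * pi * (- meet_turn)) \<and>
        sin (2 * pi * (of_int m - meet_turn)) = sin (2 * pi * (- meet_turn))"
      using sin_cos_turns_eq_iff[of "of_int m - meet_turn" "- meet_turn"] by simp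
    moreover have "sin (2 * pi * meet_turn) > 0"
      using meet_turn half_width by (intro sin_gt_zero) auto
    ultimately show ?thesis
      unfolding passages_after using meet_turn half_width m by simp
  qed
  moreover have "finite (passages k Neg after \<inter> {\<tau>..<\<tau> + 1/2})"
    by (rule finite_subset[OF _ finite_passages[OF is_diagram_after k, of Neg \<tau> "\<tau> + 1/2"]]) auto
  moreover have "card (passages k Neg after \<inter> {\<tau>..<\<tau> + 1/2}) \<le> card (passages k Pos after \<inter> {\<tau>..<\<tau> + 1/2})"
    using \<tau>(2) unfolding ballot_def by (rule bspec) simp
  ultimately show False by auto
qed

text \<open>
  In the moves \<open>\<Omega>2a\<close> and \<open>\<Omega>2d\<close> the over-strand meets the positive crossing first, in
  \<open>\<Omega>2a\<close> and \<open>\<Omega>2c\<close> the under-strand does. This decides which component is followed.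
\<close>

lemma move_balanced:
  assumes "k \<le> 1" and m: "m \<in> S_b \<union> {Omega2a, if k = 0 then Omega2d else Omega2c}" and move: "is_move m C D E"
  obtains As where "replacement C As D E" "balanced_on k As D E"
proof -
  have "\<exists>As. replacement C As D E \<and> balanced_on k As D E"
  proof (cases m)
    case (Omega1 e r)
    then show ?thesis using move move1_balanced assms(1) by (auto simp: move1_def)
  next
    case Omega3b
    then show ?thesis using move move3_balanced assms(1) by (auto simp: move3b_def)
  next
    case Omega2a
    then show ?thesis using move move2_balanced[of C _ _ D E "(True, True)"] assms(1) by (auto simp: move2_def)
  next
    case Omega2b
    then show ?thesis using m by (auto simp: S_b_def split: if_splits)
  next
    case Omega2c
    then have "k \<noteq> 0" using m by (auto simp: S_b_def split: if_splits)
    then show ?thesis using Omega2c move move2_balanced[of C _ _ D E "(False, True)"] assms(1)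
      by (auto simp: move2_def)
  next
    case Omega2d
    then have "k = 0" using m by (auto simp: S_b_def split: if_splits)
    then show ?thesis using Omega2d move move2_balanced[of C _ _ D E "(True, False)"] assms(1)
      by (auto simp: move2_def)
  qed
  then show thesis using that by blast
qed

lemma step_based_ballot:
  fixes k :: nat
  assumes k: "k \<le> 1" and step: "step_in (S_b \<union> {Omega2a, if k = 0 then Omega2d else Omega2c}) C D E"
    and z: "z \<notin> C" and D: "based_ballot k z D"
  shows "based_ballot k z E"
proof -
  consider "same_diagram D E" | "isotopic_in C D E" |
    (move) m C' where "m \<in> S_b \<union> {Omega2a, if k = 0 then Omega2d else Omega2c}" "C' \<subseteq> C"
      "is_move m C' D E \<or> is_move m C' E D"
    using step unfolding step_in_def by blast
  then show ?thesis
  proof cases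
    case 1
    then show ?thesis using same_diagram_based_ballot k D by blast
  next
    case 2
    then show ?thesis using isotopic_based_ballot k z D by blast
  next
    case move
    have z': "z \<notin> C'" using z move(2) by blast
    from move(3) show ?thesis
    proof
      assume "is_move m C' D E"
      then show ?thesis
        using move_balanced[OF k move(1)] replacement_based_ballot[OF _ k z' _ D] by metis
    next
      assume "is_move m C' E D"
      then show ?thesis
        using move_balanced[OF k move(1)] replacement_based_ballot[OF _ k z' _ D]
          replacement_sym balanced_on_sym by metis
    qed
  qed
qed

text \<open>
  Both generating sets are treated at once: \<open>k = 0\<close> for \<open>\<Omega>2d\<close> and \<open>k = 1\<close> for \<open>\<Omega>2c\<close>.
\<close>

lemma not_generates_Omega2b:
  fixes k :: nat
  assumes k: "k \<le> 1"
  shows "\<not> generates (S_b \<union> {Omega2a, if k = 0 then Omega2d else Omega2c}) Omega2b"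
proof
  let ?S = "S_b \<union> {Omega2a, if k = 0 then Omega2d else Omega2c}"
  assume "generates ?S Omega2b"
  moreover have "is_move Omega2b (cball 0 1) before after" using move2_before_after by simp
  ultimately have "(step_in ?S (cball 0 1))\<^sup>*\<^sup>* before after" unfolding generates_def by blast
  then have "based_ballot k (far_point k) after"
  proof (induction rule: rtranclp_induct)
    case base
    show ?case by (rule based_ballot_before[OF k])
  next
    case (step D E)
    then show ?case using step_based_ballot[OF k _ far_point_outside] by blast
  qed
  then show False using not_based_ballot_after[OF k] by blast
qed

theorem corollary3p5:
  shows "\<not> generates (S_b \<union> {Omega2a, Omega2c}) Omega2b \<and>
         \<not> generates (S_b \<union> {Omega2a, Omega2d}) Omega2b"
  using not_generates_Omega2b[of 1] not_generates_Omega2b[of 0] by simp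

end
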